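(* Let $G$ be a second countable locally compact abelian group, let $\Delta$ be a closed subgroup of $G\times\widehat{G}$, and let $g\in L^2(G)$. If $\{\pi(\nu)g\}_{\nu\in\Delta}$ is a frame for $L^2(G)$ with bounds $0<A\le B<\infty$, then the following holds: (i) the quotient group $(G\times\widehat{G})/\Delta$ is compact, i.e., $\mathrm{d}(\Delta)<\infty$; (ii) $A\,\mathrm{d}(\Delta)\le\|g\|^2\le B\,\mathrm{d}(\Delta)$.
   Context: $G$ is written multiplicatively and carries a fixed Haar measure; the dual group $\widehat{G}$ carries the dual Haar measure (so that the Plancherel theorem holds), and $G\times\widehat{G}$ the product measure. For $\lambda\in G$, $\gamma\in\widehat{G}$, the operators on $L^2(G)$ are $(T_\lambda f)(x)=f(x\lambda^{-1})$, $(E_\gamma f)(x)=\gamma(x)f(x)$, and $\pi(\nu)=E_\gamma T_\lambda$ for $\nu=(\lambda,\gamma)\in G\times\widehat{G}$. The closed subgroup $\Delta$ carries a fixed Haar measure $d\nu$, and $(G\times\widehat{G})/\Delta$ carries the unique Haar measure $d\dot\chi$ for which Weil's formula $\int_{G\times\widehat{G}}f(\chi)\,d\chi=\int_{(G\times\widehat{G})/\Delta}\int_\Delta f(\chi\nu)\,d\nu\,d\dot\chi$ holds for all $f\in L^1(G\times\widehat{G})$. The size of $\Delta$ is $\mathrm{d}(\Delta):=\int_{(G\times\widehat{G})/\Delta}1\,d\dot\chi\in(0,\infty]$. The system $\{\pi(\nu)g\}_{\nu\in\Delta}$ is a frame for $L^2(G)$ with bounds $A,B$ if $A\|f\|^2\le\int_\Delta|\langle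 f,\pi(\nu)g\rangle|^2\,d\nu\le B\|f\|^2$ for all $f\in L^2(G)$. *)

theory Defs
  imports "HOL-Analysis.Analysis" "HOL-Algebra.Coset"
begin

section \<open>Locally compact abelian groups\<close>

text \<open>A group of the \<open>HOL-Algebra\<close> library together with an abstract topology on its
  carrier. As usual, locally compact groups are Hausdorff by convention.\<close>

locale lca_group = comm_group G
  for G (structure) and T :: "'a topology" +
  assumes topspace_eq: "topspace T = carrier G"
    and continuous_mult: "continuous_map (prod_topology T T) T (\<lambda>(x, y). x \<otimes> y)"
    and continuous_inv: "continuous_map T T (\<lambda>x. inv x)"
    and Hausdorff: "Hausdorff_space T"
    and locally_compact: "locally_compact_space T"

text \<open>Haar measures are nonzero translation invariant Radon measures on the Borel sets. For
  second countable groups the two regularity conditions are automatic.\<close>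

definition haar_measure ::
    "('a, 'b) monoid_scheme \<Rightarrow> 'a topology \<Rightarrow> 'a measure \<Rightarrow> bool" where
  "haar_measure G T m \<longleftrightarrow>
     sets m = sets (sigma (topspace T) {U. openin T U}) \<and>
     (\<forall>x\<in>carrier G. \<forall>E\<in>sets m. emeasure m (x <#\<^bsub>G\<^esub> E) = emeasure m E) \<and>
     emeasure m (space m) \<noteq> 0 \<and>
     (\<forall>K. compactin T K \<longrightarrow> emeasure m K < \<infinity>) \<and>
     (\<forall>E\<in>sets m. emeasure m E = (INF U\<in>{U. openin T U \<and> E \<subseteq> U}. emeasure m U)) \<and>
     (\<forall>U. openin T U \<longrightarrow> emeasure m U = (SUP K\<in>{K. compactin T K \<and> K \<subseteq> U}. emeasure m K))"

section \<open>The dual group\<close>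

definition circle_group :: "complex monoid" where
  "circle_group = \<lparr>carrier = {z. cmod z = 1}, mult = (*), one = 1\<rparr>"

text \<open>Characters are extensional functions, so that they are determined by their values on the
  carrier of the group.\<close>

definition characters :: "('a, 'b) monoid_scheme \<Rightarrow> 'a topology \<Rightarrow> ('a \<Rightarrow> complex) set" where
  "characters G T =
     {\<gamma> \<in> hom G circle_group. \<gamma> \<in> extensional (carrier G) \<and> continuous_map T euclidean \<gamma>}"

definition dual_group :: "('a, 'b) monoid_scheme \<Rightarrow> 'a topology \<Rightarrow> ('a \<Rightarrow> complex) monoid" where
  "dual_group G T =
     \<lparr>carrier = characters G T,
      mult = (\<lambda>\<gamma> \<eta>. \<lambda>x\<in>carrier G. \<gamma> x * \<eta> x),
      one = (\<lambda>x\<in>carrier G. 1)\<rparr>"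

text \<open>The compact-open topology.\<close>

definition dual_topology :: "('a, 'b) monoid_scheme \<Rightarrow> 'a topology \<Rightarrow> ('a \<Rightarrow> complex) topology" where
  "dual_topology G T =
     topology_generated_by {{\<gamma> \<in> characters G T. \<gamma> ` K \<subseteq> U} |K U. compactin T K \<and> open U}"

section \<open>Square integrable functions and the dual Haar measure\<close>

text \<open>Elements of \<open>L\<^sup>2\<close> are represented by square integrable functions, without
  passing to classes modulo null functions.\<close>

definition L2 :: "'a measure \<Rightarrow> ('a \<Rightarrow> complex) set" where
  "L2 m = {f \<in> borel_measurable m. integrable m (\<lambda>x. (cmod (f x))\<^sup>2)}"

definition L2_inner :: "'a measure \<Rightarrow> ('a \<Rightarrow> complex) \<Rightarrow> ('a \<Rightarrow> complex) \<Rightarrow> complex" where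
  "L2_inner m f h = (\<integral>x. f x * cnj (h x) \<partial>m)"

definition L2_norm :: "'a measure \<Rightarrow> ('a \<Rightarrow> complex) \<Rightarrow> real" where
  "L2_norm m f = sqrt (\<integral>x. (cmod (f x))\<^sup>2 \<partial>m)"

definition fourier :: "'a measure \<Rightarrow> ('a \<Rightarrow> complex) \<Rightarrow> ('a \<Rightarrow> complex) \<Rightarrow> complex" where
  "fourier m f \<gamma> = (\<integral>x. f x * cnj (\<gamma> x) \<partial>m)"

text \<open>The normalization by Plancherel's theorem: the Fourier transform on \<open>L\<^sup>1 \<inter> L\<^sup>2\<close> is isometric
  with respect to the \<open>L\<^sup>2\<close>-norms.\<close>

definition dual_haar_measure ::
    "('a, 'b) monoid_scheme \<Rightarrow> 'a topology \<Rightarrow> 'a measure \<Rightarrow> ('a \<Rightarrow> complex) measure \<Rightarrow> bool" where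
  "dual_haar_measure G T m m' \<longleftrightarrow>
     haar_measure (dual_group G T) (dual_topology G T) m' \<and>
     (\<forall>f. integrable m f \<and> f \<in> L2 m \<longrightarrow>
        fourier m f \<in> L2 m' \<and> L2_norm m' (fourier m f) = L2_norm m f)"

section \<open>The time-frequency plane and its quotients\<close>

abbreviation tf_group ::
    "('a, 'b) monoid_scheme \<Rightarrow> 'a topology \<Rightarrow> ('a \<times> ('a \<Rightarrow> complex)) monoid" where
  "tf_group G T \<equiv> G \<times>\<times> dual_group G T"

abbreviation tf_topology ::
    "('a, 'b) monoid_scheme \<Rightarrow> 'a topology \<Rightarrow> ('a \<times> ('a \<Rightarrow> complex)) topology" where
  "tf_topology G T \<equiv> prod_topology T (dual_topology G T)"

text \<open>The quotient topology on the set of cosets of \<open>H\<close>.\<close>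

definition coset_topology :: "('a, 'b) monoid_scheme \<Rightarrow> 'a topology \<Rightarrow> 'a set \<Rightarrow> 'a set topology" where
  "coset_topology G T H =
     topology (\<lambda>U. U \<subseteq> rcosets\<^bsub>G\<^esub> H \<and> openin T {x \<in> carrier G. H #>\<^bsub>G\<^esub> x \<in> U})"

lemma openin_coset_topology:
  "openin (coset_topology G T H) U \<longleftrightarrow>
     U \<subseteq> rcosets\<^bsub>G\<^esub> H \<and> openin T {x \<in> carrier G. H #>\<^bsub>G\<^esub> x \<in> U}"
proof -
  let ?P = "\<lambda>U. U \<subseteq> rcosets\<^bsub>G\<^esub> H \<and> openin T {x \<in> carrier G. H #>\<^bsub>G\<^esub> x \<in> U}"
  have "?P (S \<inter> S')" if "?P S" "?P S'" for S S'
  proof -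
    have "{x \<in> carrier G. H #>\<^bsub>G\<^esub> x \<in> S \<inter> S'} =
        {x \<in> carrier G. H #>\<^bsub>G\<^esub> x \<in> S} \<inter> {x \<in> carrier G. H #>\<^bsub>G\<^esub> x \<in> S'}" by blast
    then show ?thesis using that by (auto intro: openin_Int)
  qed
  moreover have "?P (\<Union>\<K>)" if "\<forall>S\<in>\<K>. ?P S" for \<K>
  proof -
    have "{x \<in> carrier G. H #>\<^bsub>G\<^esub> x \<in> \<Union>\<K>} = (\<Union>S\<in>\<K>. {x \<in> carrier G. H #>\<^bsub>G\<^esub> x \<in> S})" by blast
    moreover have "openin T (\<Union>S\<in>\<K>. {x \<in> carrier G. H #>\<^bsub>G\<^esub> x \<in> S})"
      using that by (intro openin_Union) blast
    ultimately show ?thesis using that by (metis Sup_least)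
  qed
  ultimately have "istopology ?P" unfolding istopology_def by blast
  then show ?thesis
    unfolding coset_topology_def by (simp add: topology_inverse')
qed

lemma quotient_map_coset_topology:
  assumes "topspace T = carrier G"
  shows "quotient_map T (coset_topology G T H) (\<lambda>x. H #>\<^bsub>G\<^esub> x)"
proof -
  have "{x \<in> carrier G. H #>\<^bsub>G\<^esub> x \<in> rcosets\<^bsub>G\<^esub> H} = topspace T"
    by (auto simp: assms RCOSETS_def)
  then have "openin (coset_topology G T H) (rcosets\<^bsub>G\<^esub> H)"
    by (simp add: openin_coset_topology)
  then have "topspace (coset_topology G T H) = rcosets\<^bsub>G\<^esub> H"
    by (metis openin_coset_topology openin_subset openin_topspace subset_antisym)
  then show ?thesis
    by (auto simp: quotient_map_def openin_coset_topology assms RCOSETS_def)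
qed

text \<open>Weil's formula relating a measure \<open>m\<close> on \<open>H\<close>, a measure \<open>d\<close> on a subgroup, and a measure \<open>q\<close>
  on the set of its cosets. Invariance of \<open>d\<close> makes the inner integral independent of the
  representative chosen in the coset \<open>C\<close>. On the time-frequency plane of a second countable
  group, \<open>m\<close> is the binary product of the two Haar measures; the product sigma-algebra is
  then the Borel sigma-algebra of the product topology.\<close>

definition weil_formula ::
    "('a, 'b) monoid_scheme \<Rightarrow> 'a measure \<Rightarrow> 'a measure \<Rightarrow> 'a set measure \<Rightarrow> bool" where
  "weil_formula H m d q \<longleftrightarrow>
     (\<forall>f :: 'a \<Rightarrow> complex. integrable m f \<longrightarrow>
        (\<integral>z. f z \<partial>m) = (\<integral>C. (\<integral>\<nu>. f ((SOME z. z \<in> C) \<otimes>\<^bsub>H\<^esub> \<nu>) \<partial>d) \<partial>q))"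

definition subgroup_size :: "'a set measure \<Rightarrow> ennreal" where
  "subgroup_size q = (\<integral>\<^sup>+ C. 1 \<partial>q)"

section \<open>Gabor systems\<close>

definition translation_op ::
    "('a, 'b) monoid_scheme \<Rightarrow> 'a \<Rightarrow> ('a \<Rightarrow> complex) \<Rightarrow> 'a \<Rightarrow> complex" where
  "translation_op G l f = (\<lambda>x. f (x \<otimes>\<^bsub>G\<^esub> inv\<^bsub>G\<^esub> l))"

definition modulation_op :: "('a \<Rightarrow> complex) \<Rightarrow> ('a \<Rightarrow> complex) \<Rightarrow> 'a \<Rightarrow> complex" where
  "modulation_op \<gamma> f = (\<lambda>x. \<gamma> x * f x)"

definition tf_shift ::
    "('a, 'b) monoid_scheme \<Rightarrow> 'a \<times> ('a \<Rightarrow> complex) \<Rightarrow> ('a \<Rightarrow> complex) \<Rightarrow> 'a \<Rightarrow> complex" where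
  "tf_shift G \<nu> f = modulation_op (snd \<nu>) (translation_op G (fst \<nu>) f)"

text \<open>The index set \<open>\<Delta>\<close> of the Gabor system is the underlying space of its Haar measure \<open>d\<close>.\<close>

definition gabor_frame ::
    "('a, 'b) monoid_scheme \<Rightarrow> 'a measure \<Rightarrow> ('a \<times> ('a \<Rightarrow> complex)) measure \<Rightarrow>
     ('a \<Rightarrow> complex) \<Rightarrow> real \<Rightarrow> real \<Rightarrow> bool" where
  "gabor_frame G m d g A B \<longleftrightarrow>
     (\<forall>f\<in>L2 m.
        ennreal (A * (L2_norm m f)\<^sup>2) \<le> (\<integral>\<^sup>+ \<nu>. ennreal ((cmod (L2_inner m f (tf_shift G \<nu> g)))\<^sup>2) \<partial>d) \<and>
        (\<integral>\<^sup>+ \<nu>. ennreal ((cmod (L2_inner m f (tf_shift G \<nu> g)))\<^sup>2) \<partial>d) \<le> ennreal (B * (L2_norm m f)\<^sup>2))"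

end

theory Submission
  imports Defs
begin

text \<open>Why the theorem holds. For \<open>f\<close> in \<open>L\<^sup>2\<close> put \<open>F z = |\<langle>f, \<pi>(z) g\<rangle>|\<^sup>2\<close> on the time-frequency plane. Two
  facts evaluate the integral of \<open>F\<close> over the plane.

  The orthogonality relation (\<open>orthogonality_relation\<close>) says that it equals \<open>\<parallel>f\<parallel>\<^sup>2 \<parallel>g\<parallel>\<^sup>2\<close>: for a fixed
  translation \<open>l\<close>, the function \<open>\<gamma> \<mapsto> \<langle>f, E\<^sub>\<gamma> T\<^sub>l g\<rangle>\<close> is the Fourier transform of \<open>f \<cdot> cnj (T\<^sub>l g)\<close>, so
  Plancherel's theorem turns the integral over the dual group into an integral over \<open>G\<close>, and
  integrating over \<open>l\<close> gives the product of the norms by Tonelli's theorem.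

  Weil's formula computes the same integral as that of \<open>\<Phi> C = \<integral> F (z \<nu>) d\<nu>\<close> over the cosets
  \<open>C = \<Delta> z\<close>. Since \<open>|\<langle>f, \<pi>(z \<nu>) g\<rangle>| = |\<langle>\<pi>(z)\<^sup>* f, \<pi>(\<nu>) g\<rangle>|\<close> (\<open>cmod_L2_inner_tf_shift_mult\<close>) and
  \<open>\<pi>(z)\<^sup>* f\<close> has the norm of \<open>f\<close>, the frame inequality for \<open>\<pi>(z)\<^sup>* f\<close> bounds \<open>\<Phi> C\<close> between \<open>A \<parallel>f\<parallel>\<^sup>2\<close> and
  \<open>B \<parallel>f\<parallel>\<^sup>2\<close>. Taking any \<open>f\<close> of positive norm, integrating these bounds over the quotient and
  dividing by \<open>\<parallel>f\<parallel>\<^sup>2\<close> gives both inequalities, and the lower one shows that the quotient has finite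
  measure.

  A topological group with a finite Haar measure is compact (\<open>haar_measure_finite_imp_compact\<close>):
  inner regularity provides a compact set \<open>K\<close> of more than half the total mass, every translate
  \<open>x K\<close> then meets \<open>K\<close>, and so the group is \<open>K K\<^sup>-\<^sup>1\<close>. Continuity of \<open>(x, y) \<mapsto> x y\<^sup>-\<^sup>1\<close> on the
  quotient comes from the dual group being a topological group in the compact-open topology
  (\<open>continuous_map_dual\<close>).

  Tonelli's theorem needs the measures to be sigma-finite. For the dual measure this follows from
  Plancherel's theorem itself (\<open>sigma_finite_dual\<close>): the sets where the Fourier transforms of
  indicators of small open sets are bounded away from zero have finite measure, and countably many
  of them cover the dual group.\<close>

section \<open>Borel sigma-algebras of abstract topologies\<close>

definition borel_of :: "'a topology \<Rightarrow> 'a measure" where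
  "borel_of T = sigma (topspace T) {U. openin T U}"

lemma space_borel_of [simp]: "space (borel_of T) = topspace T"
  unfolding borel_of_def by (intro space_measure_of_conv)

lemma openin_sets_borel_of: "openin T U \<Longrightarrow> U \<in> sets (borel_of T)"
  unfolding borel_of_def by (subst sets_measure_of) (auto dest: openin_subset)

lemma closedin_sets_borel_of: "closedin T C \<Longrightarrow> C \<in> sets (borel_of T)"
  by (metis closedin_def double_diff openin_sets_borel_of sets.compl_sets space_borel_of subset_refl)

lemma measurable_borel_of_iff:
  "f \<in> M \<rightarrow>\<^sub>M borel_of T \<longleftrightarrow>
     f \<in> space M \<rightarrow> topspace T \<and> (\<forall>U. openin T U \<longrightarrow> f -` U \<inter> space M \<in> sets M)"
proof
  assume f: "f \<in> M \<rightarrow>\<^sub>M borel_of T"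
  show "f \<in> space M \<rightarrow> topspace T \<and> (\<forall>U. openin T U \<longrightarrow> f -` U \<inter> space M \<in> sets M)"
    using measurable_space[OF f] measurable_sets[OF f openin_sets_borel_of] by auto
next
  assume "f \<in> space M \<rightarrow> topspace T \<and> (\<forall>U. openin T U \<longrightarrow> f -` U \<inter> space M \<in> sets M)"
  then show "f \<in> M \<rightarrow>\<^sub>M borel_of T"
    unfolding borel_of_def by (intro measurable_measure_of) (auto dest: openin_subset)
qed

lemma sets_borel_of_euclidean: "sets (borel_of euclidean) = sets borel"
  by (simp add: borel_of_def borel_def)

lemma continuous_map_measurable:
  "continuous_map S T f \<Longrightarrow> f \<in> borel_of S \<rightarrow>\<^sub>M borel_of T"
  unfolding measurable_borel_of_iff
proof (intro conjI allI impI)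
  assume f: "continuous_map S T f"
  then show "f \<in> space (borel_of S) \<rightarrow> topspace T"
    by (auto simp: continuous_map_def)
  fix U assume "openin T U"
  with f have "openin S {x \<in> topspace S. f x \<in> U}"
    by (auto simp: continuous_map_def)
  moreover have "f -` U \<inter> space (borel_of S) = {x \<in> topspace S. f x \<in> U}" by auto
  ultimately show "f -` U \<inter> space (borel_of S) \<in> sets (borel_of S)"
    by (simp add: openin_sets_borel_of)
qed

lemma continuous_map_borel_measurable:
  "continuous_map S euclidean f \<Longrightarrow> f \<in> borel_measurable (borel_of S)"
  using continuous_map_measurable[of S euclidean f] measurable_cong_sets[OF refl sets_borel_of_euclidean]
  by blast

lemma id_measurable_borel_of_prod:
  "(\<lambda>z. z) \<in> borel_of (prod_topology S T) \<rightarrow>\<^sub>M borel_of S \<Otimes>\<^sub>M borel_of T"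
  using measurable_Pair[OF continuous_map_measurable[OF continuous_map_fst]
      continuous_map_measurable[OF continuous_map_snd], of S T]
  by simp

text \<open>Second countability makes the product sigma-algebra contain all open sets of the product
  topology: an open set is the union of the countably many basic rectangles inside it.\<close>

lemma id_measurable_prod_borel_of:
  assumes "second_countable S" "second_countable T"
  shows "(\<lambda>z. z) \<in> borel_of S \<Otimes>\<^sub>M borel_of T \<rightarrow>\<^sub>M borel_of (prod_topology S T)"
  unfolding measurable_borel_of_iff
proof (intro conjI allI impI)
  show "(\<lambda>z. z) \<in> space (borel_of S \<Otimes>\<^sub>M borel_of T) \<rightarrow> topspace (prod_topology S T)"
    by (rule Pi_I) (simp add: space_pair_measure)
  from assms(1) obtain \<A> where \<A>: "countable \<A> \<and> (\<forall>V\<in>\<A>. openin S V) \<and>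
      (\<forall>U x. openin S U \<and> x \<in> U \<longrightarrow> (\<exists>V\<in>\<A>. x \<in> V \<and> V \<subseteq> U))"
    unfolding second_countable_def ..
  from assms(2) obtain \<B> where \<B>: "countable \<B> \<and> (\<forall>V\<in>\<B>. openin T V) \<and>
      (\<forall>U x. openin T U \<and> x \<in> U \<longrightarrow> (\<exists>V\<in>\<B>. x \<in> V \<and> V \<subseteq> U))"
    unfolding second_countable_def ..
  fix W assume W: "openin (prod_topology S T) W"
  define I where "I = {p \<in> \<A> \<times> \<B>. fst p \<times> snd p \<subseteq> W}"
  have "W \<subseteq> (\<Union>p\<in>I. fst p \<times> snd p)"
  proof clarify
    fix x y assume xy: "(x, y) \<in> W"
    with W have "\<exists>U V. openin S U \<and> openin T V \<and> x \<in> U \<and> y \<in> V \<and> U \<times> V \<subseteq> W"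
      unfolding openin_prod_topology_alt by simp
    then obtain U V where UV: "openin S U" "openin T V" "x \<in> U" "y \<in> V" "U \<times> V \<subseteq> W"
      by blast
    have "\<exists>V\<in>\<A>. x \<in> V \<and> V \<subseteq> U" using \<A> UV by simp
    then obtain U' where U': "U' \<in> \<A>" "x \<in> U'" "U' \<subseteq> U" by blast
    have "\<exists>V'\<in>\<B>. y \<in> V' \<and> V' \<subseteq> V" using \<B> UV by simp
    then obtain V' where V': "V' \<in> \<B>" "y \<in> V'" "V' \<subseteq> V" by blast
    have "(U', V') \<in> I"
      unfolding I_def using U' V' Sigma_mono[OF U'(3) V'(3)] UV(5) by simp
    then show "(x, y) \<in> (\<Union>p\<in>I. fst p \<times> snd p)"
      by (rule UN_I) (simp add: U' V')
  qed
  moreover have "(\<Union>p\<in>I. fst p \<times> snd p) \<subseteq> W" unfolding I_def by blast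
  ultimately have W_eq: "W = (\<Union>p\<in>I. fst p \<times> snd p)" by (rule subset_antisym)
  have I: "countable I"
    unfolding I_def by (rule countable_subset[of _ "\<A> \<times> \<B>"]) (use \<A> \<B> in auto)
  have "fst p \<times> snd p \<in> sets (borel_of S \<Otimes>\<^sub>M borel_of T)" if "p \<in> I" for p
    using that \<A> \<B> unfolding I_def by (intro pair_measureI openin_sets_borel_of) auto
  then have "W \<in> sets (borel_of S \<Otimes>\<^sub>M borel_of T)"
    unfolding W_eq by (intro sets.countable_UN'[OF I]) auto
  then show "(\<lambda>z. z) -` W \<inter> space (borel_of S \<Otimes>\<^sub>M borel_of T) \<in> sets (borel_of S \<Otimes>\<^sub>M borel_of T)"
    by simp
qed

section \<open>Haar measures and compactness\<close>

lemma haar_measure_sets: "haar_measure G T m \<Longrightarrow> sets m = sets (borel_of T)"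
  by (simp add: haar_measure_def borel_of_def)

lemma haar_measure_space: "haar_measure G T m \<Longrightarrow> space m = topspace T"
  using sets_eq_imp_space_eq[OF haar_measure_sets] by simp

text \<open>Compact sets need not be Borel when the topology is not Hausdorff, but a set of positive
  \<open>emeasure\<close> always is.\<close>

lemma haar_measure_compact_approx:
  assumes "haar_measure G T m" "c < emeasure m (space m)"
  obtains K where "compactin T K" "K \<in> sets m" "c < emeasure m K"
proof -
  have "emeasure m (topspace T) = (SUP K\<in>{K. compactin T K \<and> K \<subseteq> topspace T}. emeasure m K)"
    using assms(1) unfolding haar_measure_def by blast
  with assms obtain K where K: "compactin T K" "c < emeasure m K"
    by (auto simp: haar_measure_space less_SUP_iff)
  moreover have "K \<in> sets m"
    using K(2) emeasure_notin_sets[of K m] by (cases "K \<in> sets m") auto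
  ultimately show ?thesis using that by blast
qed

lemma haar_measure_compact_finite:
  "haar_measure G T m \<Longrightarrow> compactin T K \<Longrightarrow> emeasure m K < \<infinity>"
  unfolding haar_measure_def by blast

text \<open>If \<open>K\<close> carries more than half of the total mass, then \<open>x K\<close> and \<open>K\<close> cannot be disjoint, so
  every \<open>x\<close> is of the form \<open>b a\<^sup>-\<^sup>1\<close> with \<open>a\<close>, \<open>b\<close> in \<open>K\<close>. The group is thus the continuous image of
  the compact set \<open>K \<times> K\<close>.\<close>

lemma haar_measure_finite_imp_compact:
  fixes H (structure)
  assumes "group H" and X: "topspace X = carrier H"
    and cont: "continuous_map (prod_topology X X) X (\<lambda>(x, y). x \<otimes> inv y)"
    and haar: "haar_measure H X q" and fin: "emeasure q (space q) < \<infinity>"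
  shows "compact_space X"
proof -
  interpret group H by fact
  have sp: "space q = carrier H" using haar_measure_space[OF haar] X by simp
  have nz: "emeasure q (space q) \<noteq> 0" using haar by (simp add: haar_measure_def)
  obtain M where M: "emeasure q (space q) = ennreal M" "0 < M"
    using nz fin by (cases "emeasure q (space q)") (auto simp: less_le)
  then have "ennreal (M / 2) < emeasure q (space q)"
    by (simp add: ennreal_less_iff)
  then obtain K where K: "compactin X K" "K \<in> sets q" "ennreal (M / 2) < emeasure q K"
    using haar_measure_compact_approx[OF haar] by blast
  have "emeasure q K \<noteq> \<infinity>"
    using emeasure_space[of q K] fin by (auto simp: top_unique)
  then obtain k where k: "emeasure q K = ennreal k" "0 \<le> k"
    by (cases "emeasure q K") auto
  \<comment> \<open>This is where more than half of the mass enters: two disjoint copies of \<open>K\<close> do not fit.\<close>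
  have kM: "M < k + k"
    using K(3) M(2) k by (simp add: ennreal_less_iff)
  have Kc: "K \<subseteq> carrier H" using compactin_subset_topspace[OF K(1)] X by simp
  have "x \<in> (\<lambda>(x, y). x \<otimes> inv y) ` (K \<times> K)" if x: "x \<in> carrier H" for x
  proof -
    have tr: "emeasure q (x <#\<^bsub>H\<^esub> K) = emeasure q K"
      using haar x K(2) by (simp add: haar_measure_def)
    then have xK: "x <#\<^bsub>H\<^esub> K \<in> sets q"
      using K(3) emeasure_notin_sets[of "x <#\<^bsub>H\<^esub> K" q] by (cases "x <#\<^bsub>H\<^esub> K \<in> sets q") auto
    have "(x <#\<^bsub>H\<^esub> K) \<inter> K \<noteq> {}"
    proof
      assume "(x <#\<^bsub>H\<^esub> K) \<inter> K = {}"
      then have "emeasure q (x <#\<^bsub>H\<^esub> K) + emeasure q K = emeasure q ((x <#\<^bsub>H\<^esub> K) \<union> K)"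
        using xK K(2) by (intro plus_emeasure) auto
      also have "\<dots> \<le> emeasure q (space q)"
        by (rule emeasure_space)
      finally have "k + k \<le> M" using tr k M by (simp flip: ennreal_plus)
      with kM show False by simp
    qed
    then obtain a b where "a \<in> K" "b \<in> K" "x \<otimes> a = b" by (auto simp: l_coset_def)
    then have "x = b \<otimes> inv a" using x Kc inv_solve_right by blast
    then show ?thesis using \<open>a \<in> K\<close> \<open>b \<in> K\<close> by auto
  qed
  then have "topspace X = (\<lambda>(x, y). x \<otimes> inv y) ` (K \<times> K)"
    using Kc X by auto
  moreover have "compactin X ((\<lambda>(x, y). x \<otimes> inv y) ` (K \<times> K))"
    by (rule image_compactin[OF _ cont]) (simp add: compactin_Times K(1))
  ultimately show ?thesis by (simp add: compact_space_def)
qed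

text \<open>The quotient of a topological group by a subgroup is a topological group. Products of
  quotient maps are in general not quotient maps; here the canonical projection is open, because
  the saturation of an open set is a union of translates of it, and products of open maps are
  open.\<close>

lemma continuous_map_quotient_group:
  fixes H (structure)
  assumes "comm_group H" and X: "topspace X = carrier H"
    and cont: "continuous_map (prod_topology X X) X (\<lambda>(x, y). x \<otimes> inv y)"
    and N: "subgroup N H"
  defines "Y \<equiv> coset_topology H X N"
  shows "continuous_map (prod_topology Y Y) Y (\<lambda>(C, D). C \<otimes>\<^bsub>H Mod N\<^esub> inv\<^bsub>H Mod N\<^esub> D)"
    and "topspace Y = carrier (H Mod N)"
proof -
  interpret comm_group H by fact
  interpret normal N H using N by (rule subgroup_imp_normal)
  let ?p = "\<lambda>x. N #> x"
  have qm: "quotient_map X Y ?p"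
    unfolding Y_def by (rule quotient_map_coset_topology[OF X])
  then have img: "?p ` topspace X = topspace Y" and pc: "continuous_map X Y ?p"
    by (auto simp: quotient_imp_surjective_map quotient_imp_continuous_map)
  then show tY: "topspace Y = carrier (H Mod N)"
    by (simp add: X carrier_FactGroup)
  have p_eq: "?p x = ?p y \<longleftrightarrow> (\<exists>n\<in>N. x \<otimes> inv n = y)" if "x \<in> carrier H" "y \<in> carrier H" for x y
  proof
    assume "?p x = ?p y"
    then have "y \<in> N #> x" using that rcos_self[of y N] is_subgroup by simp
    then obtain n where n: "n \<in> N" "y = n \<otimes> x" by (auto simp: r_coset_def)
    then have "y = x \<otimes> inv (inv n)" using that m_comm mem_carrier by auto
    with n show "\<exists>n\<in>N. x \<otimes> inv n = y"
      by (intro bexI[of _ "inv n"]) auto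
  next
    assume "\<exists>n\<in>N. x \<otimes> inv n = y"
    then obtain n where n: "n \<in> N" "y = x \<otimes> inv n" by blast
    then have "y = inv n \<otimes> x"
      using that(1) by (simp add: m_comm)
    with n(1) have "\<exists>h\<in>N. y = h \<otimes> x" by (intro bexI[of _ "inv n"]) auto
    then have "y \<in> N #> x" by (auto simp: r_coset_def)
    then show "?p x = ?p y" using repr_independence that is_subgroup by blast
  qed
  have op: "open_map X Y ?p"
    unfolding open_map_def
  proof (intro allI impI)
    fix U assume U: "openin X U"
    then have Uc: "U \<subseteq> carrier H" using openin_subset X by blast
    have "openin X {x \<in> topspace X. x \<otimes> inv n \<in> U}" if "n \<in> N" for n
    proof -
      have "continuous_map X X ((\<lambda>(x, y). x \<otimes> inv y) \<circ> (\<lambda>x. (x, n)))"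
        by (intro continuous_map_compose[OF _ cont])
          (use that X mem_carrier in \<open>auto intro!: continuous_map_pairedI\<close>)
      then show ?thesis using U by (auto simp: continuous_map_def)
    qed
    then have "openin X (\<Union>n\<in>N. {x \<in> topspace X. x \<otimes> inv n \<in> U})" by blast
    moreover have "{x \<in> topspace X. ?p x \<in> ?p ` U} = (\<Union>n\<in>N. {x \<in> topspace X. x \<otimes> inv n \<in> U})"
    proof -
      have "?p x \<in> ?p ` U \<longleftrightarrow> (\<exists>n\<in>N. x \<otimes> inv n \<in> U)" if "x \<in> carrier H" for x
      proof -
        have "?p x \<in> ?p ` U \<longleftrightarrow> (\<exists>y\<in>U. ?p x = ?p y)" by blast
        also have "\<dots> \<longleftrightarrow> (\<exists>y\<in>U. \<exists>n\<in>N. x \<otimes> inv n = y)"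
          using that Uc by (intro bex_cong refl p_eq) auto
        finally show ?thesis by blast
      qed
      then show ?thesis by (simp add: X set_eq_iff cong: conj_cong)
    qed
    ultimately show "openin Y (?p ` U)"
      unfolding Y_def openin_coset_topology using Uc X by (auto simp: RCOSETS_def)
  qed
  let ?P = "\<lambda>(x, y). (?p x, ?p y)"
  have P: "quotient_map (prod_topology X X) (prod_topology Y Y) ?P"
  proof (rule continuous_open_imp_quotient_map)
    show "continuous_map (prod_topology X X) (prod_topology Y Y) ?P"
      using pc by (simp add: continuous_map_prod_top)
    show "?P ` topspace (prod_topology X X) = topspace (prod_topology Y Y)"
      unfolding topspace_prod_topology img[symmetric] by auto
    show "open_map (prod_topology X X) (prod_topology Y Y) ?P"
      unfolding open_map_def
    proof (intro allI impI)
      fix W assume W: "openin (prod_topology X X) W"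
      show "openin (prod_topology Y Y) (?P ` W)"
        unfolding openin_prod_topology_alt[of Y Y]
      proof clarify
        fix x y assume "(x, y) \<in> W"
        with W have "\<exists>U V. openin X U \<and> openin X V \<and> x \<in> U \<and> y \<in> V \<and> U \<times> V \<subseteq> W"
          unfolding openin_prod_topology_alt by simp
        then obtain U V where UV: "openin X U" "openin X V" "x \<in> U" "y \<in> V" "U \<times> V \<subseteq> W"
          by blast
        have "(?p ` U) \<times> (?p ` V) = ?P ` (U \<times> V)" by auto
        also have "\<dots> \<subseteq> ?P ` W" using UV(5) by (rule image_mono)
        finally have "(?p ` U) \<times> (?p ` V) \<subseteq> ?P ` W" .
        moreover have "openin Y (?p ` U)" "openin Y (?p ` V)"
          using op UV(1,2) unfolding open_map_def by simp_all
        ultimately show "\<exists>U V. openin Y U \<and> openin Y V \<and> ?p x \<in> U \<and> ?p y \<in> V \<and> U \<times> V \<subseteq> ?P ` W"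
          using UV(3,4) by (intro exI[of _ "?p ` U"] exI[of _ "?p ` V"]) simp
      qed
    qed
  qed
  show "continuous_map (prod_topology Y Y) Y (\<lambda>(C, D). C \<otimes>\<^bsub>H Mod N\<^esub> inv\<^bsub>H Mod N\<^esub> D)"
  proof (rule continuous_compose_quotient_map[OF P])
    have eq: "?p x \<otimes>\<^bsub>H Mod N\<^esub> inv\<^bsub>H Mod N\<^esub> ?p y = ?p (x \<otimes> inv y)"
      if "x \<in> carrier H" "y \<in> carrier H" for x y
    proof -
      have "?p y \<in> carrier (H Mod N)" using that by (auto simp: carrier_FactGroup)
      then show ?thesis using that by (simp add: inv_FactGroup rcos_inv rcos_sum)
    qed
    have "continuous_map (prod_topology X X) Y (?p \<circ> (\<lambda>(x, y). x \<otimes> inv y))"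
      by (rule continuous_map_compose[OF cont pc])
    then show "continuous_map (prod_topology X X) Y
        ((\<lambda>(C, D). C \<otimes>\<^bsub>H Mod N\<^esub> inv\<^bsub>H Mod N\<^esub> D) \<circ> ?P)"
      by (rule continuous_map_eq) (simp add: X eq case_prod_beta mem_Times_iff del: mult_FactGroup)
  qed
qed

section \<open>The dual group and the time-frequency plane as topological groups\<close>

context lca_group
begin

lemma compact_closure_neighbourhood:
  assumes "openin T U" "x \<in> U"
  obtains V where "openin T V" "compactin T (T closure_of V)" "x \<in> V" "T closure_of V \<subseteq> U"
proof -
  have "neighbourhood_base_of (\<lambda>C. compactin T C \<and> closedin T C) T"
    using locally_compact Hausdorff locally_compact_space_neighbourhood_base_closedin by blast
  with assms have "\<exists>V C. openin T V \<and> (compactin T C \<and> closedin T C) \<and> x \<in> V \<and> V \<subseteq> C \<and> C \<subseteq> U"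
    unfolding neighbourhood_base_of by simp
  then obtain V C where VC: "openin T V" "compactin T C" "closedin T C" "x \<in> V" "V \<subseteq> C" "C \<subseteq> U"
    by blast
  then have "T closure_of V \<subseteq> C" by (intro closure_of_minimal)
  moreover from this have "compactin T (T closure_of V)"
    using VC by (intro closed_compactin[OF VC(2)]) auto
  ultimately show ?thesis using VC by (intro that[of V]) auto
qed

text \<open>In a second countable group the basic open sets with compact closure still form a basis.
  They serve both as sets of finite Haar measure and, through their closures, as the compact sets
  that describe the topology of the dual group.\<close>

lemma countable_compact_closure_basis:
  assumes "second_countable T"
  shows "\<exists>\<B>. countable \<B> \<and> (\<forall>V\<in>\<B>. openin T V \<and> compactin T (T closure_of V)) \<and>
    (\<forall>U x. openin T U \<and> x \<in> U \<longrightarrow> (\<exists>V\<in>\<B>. x \<in> V \<and> T closure_of V \<subseteq> U))"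
proof -
  from assms obtain \<B> where \<B>: "countable \<B> \<and> (\<forall>V\<in>\<B>. openin T V) \<and>
      (\<forall>U x. openin T U \<and> x \<in> U \<longrightarrow> (\<exists>V\<in>\<B>. x \<in> V \<and> V \<subseteq> U))"
    unfolding second_countable_def ..
  let ?C = "{V \<in> \<B>. compactin T (T closure_of V)}"
  have "\<exists>V\<in>?C. x \<in> V \<and> T closure_of V \<subseteq> U" if U: "openin T U" "x \<in> U" for U x
  proof -
    obtain W where W: "openin T W" "compactin T (T closure_of W)" "x \<in> W" "T closure_of W \<subseteq> U"
      using compact_closure_neighbourhood[OF U] .
    have "\<exists>V\<in>\<B>. x \<in> V \<and> V \<subseteq> W" using \<B> W by simp
    then obtain V where V: "V \<in> \<B>" "x \<in> V" "V \<subseteq> W" by blast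
    have "T closure_of V \<subseteq> T closure_of W" by (rule closure_of_mono[OF V(3)])
    then show ?thesis
      using V W closed_compactin[OF W(2) _ closedin_closure_of] by (intro bexI[of _ V]) auto
  qed
  then show ?thesis using \<B> by (intro exI[of _ ?C]) simp
qed

abbreviation D where "D \<equiv> dual_group G T"
abbreviation DT where "DT \<equiv> dual_topology G T"

lemma carrier_dual: "carrier D = characters G T"
  by (simp add: dual_group_def)

lemma mult_dual_apply: "x \<in> carrier G \<Longrightarrow> (\<gamma> \<otimes>\<^bsub>D\<^esub> \<eta>) x = \<gamma> x * \<eta> x"
  by (simp add: dual_group_def)

lemma
  assumes "\<gamma> \<in> characters G T"
  shows character_norm: "x \<in> carrier G \<Longrightarrow> cmod (\<gamma> x) = 1"
    and character_mult: "x \<in> carrier G \<Longrightarrow> y \<in> carrier G \<Longrightarrow> \<gamma> (x \<otimes> y) = \<gamma> x * \<gamma> y"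
    and character_continuous: "continuous_map T euclidean \<gamma>"
    and character_extensional: "\<gamma> \<in> extensional (carrier G)"
  using assms by (auto simp: characters_def circle_group_def hom_def Pi_iff)

lemma characterI:
  assumes "\<And>x. x \<in> carrier G \<Longrightarrow> cmod (\<gamma> x) = 1"
    and "\<And>x y. x \<in> carrier G \<Longrightarrow> y \<in> carrier G \<Longrightarrow> \<gamma> (x \<otimes> y) = \<gamma> x * \<gamma> y"
    and "continuous_map T euclidean \<gamma>"
  shows "restrict \<gamma> (carrier G) \<in> characters G T"
proof -
  have "continuous_map T euclidean (restrict \<gamma> (carrier G))"
    using assms(3) by (rule continuous_map_eq) (simp add: topspace_eq)
  then show ?thesis
    using assms(1,2) by (auto simp: characters_def circle_group_def hom_def Pi_iff)
qed

lemma character_mult_closed: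
  assumes "\<gamma> \<in> characters G T" "\<eta> \<in> characters G T"
  shows "restrict (\<lambda>x. \<gamma> x * \<eta> x) (carrier G) \<in> characters G T"
proof (intro characterI)
  have "continuous_map T (prod_topology euclidean euclidean) (\<lambda>x. (\<gamma> x, \<eta> x))"
    using assms by (intro continuous_map_pairedI character_continuous)
  moreover have "continuous_map (prod_topology euclidean euclidean) euclidean (\<lambda>(a, b). a * b :: complex)"
    by (auto simp: case_prod_beta intro!: continuous_intros)
  ultimately have "continuous_map T euclidean ((\<lambda>(a, b). a * b) \<circ> (\<lambda>x. (\<gamma> x, \<eta> x)))"
    by (rule continuous_map_compose)
  then show "continuous_map T euclidean (\<lambda>x. \<gamma> x * \<eta> x)" by (simp add: comp_def)
qed (use assms in \<open>auto simp: character_norm character_mult norm_mult\<close>)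

lemma character_cnj_closed:
  assumes "\<gamma> \<in> characters G T"
  shows "restrict (\<lambda>x. cnj (\<gamma> x)) (carrier G) \<in> characters G T"
proof (intro characterI)
  have "continuous_map T euclidean (cnj \<circ> \<gamma>)"
    by (rule continuous_map_compose[OF character_continuous[OF assms]])
      (simp add: continuous_on_cnj)
  then show "continuous_map T euclidean (\<lambda>x. cnj (\<gamma> x))" by (simp add: comp_def)
qed (use assms in \<open>auto simp: character_norm character_mult\<close>)

lemma character_one: "restrict (\<lambda>x. 1) (carrier G) \<in> characters G T"
  by (intro characterI) auto

lemma character_cnj_mult:
  "\<gamma> \<in> characters G T \<Longrightarrow> x \<in> carrier G \<Longrightarrow> cnj (\<gamma> x) * \<gamma> x = 1"
  using character_norm[of \<gamma> x] by (metis complex_norm_square mult.commute of_real_1 power_one)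

lemma comm_group_dual: "comm_group D"
proof (rule comm_groupI)
  fix \<gamma> assume \<gamma>: "\<gamma> \<in> carrier D"
  then show "\<one>\<^bsub>D\<^esub> \<otimes>\<^bsub>D\<^esub> \<gamma> = \<gamma>"
    using character_extensional[of \<gamma>] by (auto simp: dual_group_def extensional_def fun_eq_iff)
  show "\<exists>\<eta>\<in>carrier D. \<eta> \<otimes>\<^bsub>D\<^esub> \<gamma> = \<one>\<^bsub>D\<^esub>"
    using \<gamma> by (intro bexI[of _ "restrict (\<lambda>x. cnj (\<gamma> x)) (carrier G)"])
      (auto simp: dual_group_def character_cnj_closed fun_eq_iff character_cnj_mult)
qed (auto simp: dual_group_def character_one character_mult_closed fun_eq_iff mult.assoc mult.commute)

lemma inv_dual_apply:
  assumes "\<gamma> \<in> characters G T" "x \<in> carrier G"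
  shows "(inv\<^bsub>D\<^esub> \<gamma>) x = cnj (\<gamma> x)"
proof -
  interpret D: comm_group D by (rule comm_group_dual)
  have "restrict (\<lambda>x. cnj (\<gamma> x)) (carrier G) \<otimes>\<^bsub>D\<^esub> \<gamma> = \<one>\<^bsub>D\<^esub>"
    using assms by (auto simp: dual_group_def fun_eq_iff character_cnj_mult)
  then have "inv\<^bsub>D\<^esub> \<gamma> = restrict (\<lambda>x. cnj (\<gamma> x)) (carrier G)"
    using assms(1) by (intro D.inv_equality) (simp_all add: carrier_dual character_cnj_closed)
  then show ?thesis using assms(2) by simp
qed

lemma openin_dual_topology:
  "compactin T K \<Longrightarrow> open U \<Longrightarrow> openin DT {\<gamma> \<in> characters G T. \<gamma> ` K \<subseteq> U}"
  unfolding dual_topology_def by (intro topology_generated_by_Basis) blast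

lemma topspace_dual: "topspace DT = characters G T"
proof -
  have "{\<gamma> \<in> characters G T. \<gamma> ` {} \<subseteq> UNIV} \<in>
      {{\<gamma> \<in> characters G T. \<gamma> ` K \<subseteq> U} |K U. compactin T K \<and> open U}"
    using compactin_empty open_UNIV by (intro CollectI exI conjI) (rule refl)
  then show ?thesis
    unfolding dual_topology_def topology_generated_by_topspace by auto
qed

text \<open>The conclusion puts \<open>\<gamma>\<close> into the basic open set of the compact-open topology given by the
  closure of \<open>V\<close> and by \<open>U\<close>.\<close>

lemma character_closure_neighbourhood:
  assumes "\<gamma> \<in> characters G T" "x \<in> carrier G" "open U" "\<gamma> x \<in> U"
  obtains V where "openin T V" "compactin T (T closure_of V)" "x \<in> V" "\<gamma> ` (T closure_of V) \<subseteq> U"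
proof -
  have "openin T {y \<in> topspace T. \<gamma> y \<in> U}"
    using character_continuous[OF assms(1)] assms(3) by (simp add: continuous_map_def)
  moreover have "x \<in> {y \<in> topspace T. \<gamma> y \<in> U}" using assms by (simp add: topspace_eq)
  ultimately show ?thesis
    by (rule compact_closure_neighbourhood) (auto intro: that)
qed

text \<open>Let \<open>\<gamma>\<^sub>0 \<eta>\<^sub>0\<^sup>-\<^sup>1\<close> map a compact set \<open>K\<close> into an open set \<open>U\<close>. Around each point of \<open>K\<close> there are
  a set \<open>V\<close> with compact closure and open sets \<open>A\<close>, \<open>B\<close> with \<open>A \<cdot> cnj B \<subseteq> U\<close> such that \<open>\<gamma>\<^sub>0\<close> and \<open>\<eta>\<^sub>0\<close>
  map the closure of \<open>V\<close> into \<open>A\<close> and \<open>B\<close>. Finitely many such \<open>V\<close> cover \<open>K\<close>, and mapping their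
  closures into the corresponding \<open>A\<close> and \<open>B\<close> are open conditions on \<open>\<gamma>\<close> and \<open>\<eta>\<close> that imply
  \<open>(\<gamma> \<eta>\<^sup>-\<^sup>1) K \<subseteq> U\<close>.\<close>

lemma continuous_map_dual:
  "continuous_map (prod_topology DT DT) DT (\<lambda>(\<gamma>, \<eta>). \<gamma> \<otimes>\<^bsub>D\<^esub> inv\<^bsub>D\<^esub> \<eta>)"
proof -
  interpret D: comm_group D by (rule comm_group_dual)
  let ?f = "\<lambda>(\<gamma>, \<eta>). \<gamma> \<otimes>\<^bsub>D\<^esub> inv\<^bsub>D\<^esub> \<eta>"
  let ?N = "\<lambda>K U. {\<gamma> \<in> characters G T. \<gamma> ` K \<subseteq> U}"
  have f: "?f ` topspace (prod_topology DT DT) \<subseteq> characters G T"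
    using D.m_closed D.inv_closed by (auto simp: topspace_dual carrier_dual)
  have f_apply: "(\<gamma> \<otimes>\<^bsub>D\<^esub> inv\<^bsub>D\<^esub> \<eta>) x = \<gamma> x * cnj (\<eta> x)"
    if "\<eta> \<in> characters G T" "x \<in> carrier G" for \<gamma> \<eta> x
    using that by (simp add: mult_dual_apply inv_dual_apply)
  have "openin (prod_topology DT DT) (?f -` ?N K U \<inter> topspace (prod_topology DT DT))"
    if K: "compactin T K" and U: "open U" for K U
    unfolding openin_prod_topology_alt
  proof (intro allI impI)
    fix \<gamma> \<eta> assume "(\<gamma>, \<eta>) \<in> ?f -` ?N K U \<inter> topspace (prod_topology DT DT)"
    then have \<gamma>\<eta>: "(\<gamma>, \<eta>) \<in> topspace (prod_topology DT DT)"
      and KU: "(\<gamma> \<otimes>\<^bsub>D\<^esub> inv\<^bsub>D\<^esub> \<eta>) ` K \<subseteq> U" by auto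
    have ch: "\<gamma> \<in> characters G T" "\<eta> \<in> characters G T" using \<gamma>\<eta> by (auto simp: topspace_dual)
    have Kc: "K \<subseteq> carrier G" using compactin_subset_topspace[OF K] topspace_eq by simp
    \<comment> \<open>\<open>R\<close> collects the admissible triples; covering \<open>K\<close> by their first components avoids
        choosing one triple for each point.\<close>
    define R where "R = {(V, A, B). openin T V \<and> compactin T (T closure_of V) \<and> open A \<and> open B \<and>
        \<gamma> ` (T closure_of V) \<subseteq> A \<and> \<eta> ` (T closure_of V) \<subseteq> B \<and> (\<forall>a\<in>A. \<forall>b\<in>B. a * cnj b \<in> U)}"
    have cover: "x \<in> \<Union>(fst ` R)" if x: "x \<in> K" for x
    proof -
      have xc: "x \<in> carrier G" using x Kc by blast
      have "(\<gamma> \<otimes>\<^bsub>D\<^esub> inv\<^bsub>D\<^esub> \<eta>) x \<in> U" using KU x by auto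
      then have "\<gamma> x * cnj (\<eta> x) \<in> U" using f_apply[OF ch(2) xc] by simp
      moreover have "open ((\<lambda>(a, b). a * cnj b) -` U)"
        by (intro open_vimage[OF U] continuous_intros) (auto simp: case_prod_beta intro!: continuous_intros)
      ultimately obtain A B where AB: "open A" "open B" "\<gamma> x \<in> A" "\<eta> x \<in> B"
          "A \<times> B \<subseteq> (\<lambda>(a, b). a * cnj b) -` U"
        by (elim open_prod_elim[where x = "(\<gamma> x, \<eta> x)"]) auto
      obtain V where V: "openin T V" "compactin T (T closure_of V)" "x \<in> V" "\<gamma> ` (T closure_of V) \<subseteq> A"
        using character_closure_neighbourhood[OF ch(1) xc AB(1,3)] .
      obtain W where W: "openin T W" "compactin T (T closure_of W)" "x \<in> W" "\<eta> ` (T closure_of W) \<subseteq> B"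
        using character_closure_neighbourhood[OF ch(2) xc AB(2,4)] .
      have sub: "T closure_of (V \<inter> W) \<subseteq> T closure_of V" "T closure_of (V \<inter> W) \<subseteq> T closure_of W"
        by (simp_all add: closure_of_mono)
      have "(V \<inter> W, A, B) \<in> R"
        unfolding R_def
        using AB(1,2,5) openin_Int[OF V(1) W(1)] closed_compactin[OF V(2) sub(1) closedin_closure_of]
          subset_trans[OF image_mono[OF sub(1)] V(4)] subset_trans[OF image_mono[OF sub(2)] W(4)]
        by auto
      then show ?thesis using V(3) W(3) by (intro UnionI[of "V \<inter> W"] image_eqI[of _ _ "(V \<inter> W, A, B)"]) auto
    qed
    have "\<exists>\<F>. finite \<F> \<and> \<F> \<subseteq> fst ` R \<and> K \<subseteq> \<Union>\<F>"
      using cover by (intro compactinD[OF K]) (auto simp: R_def)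
    then obtain \<F> where \<F>: "finite \<F>" "\<F> \<subseteq> fst ` R" "K \<subseteq> \<Union>\<F>" by blast
    obtain F where F: "F \<subseteq> R" "finite F" "\<F> = fst ` F"
      using finite_subset_image[OF \<F>(1,2)] by blast
    define P where "P = topspace DT \<inter> (\<Inter>(V, A, B)\<in>F. ?N (T closure_of V) A)"
    define Q where "Q = topspace DT \<inter> (\<Inter>(V, A, B)\<in>F. ?N (T closure_of V) B)"
    have "openin DT P" "openin DT Q"
      unfolding P_def Q_def using F(1,2)
      by (auto simp: R_def intro!: openin_Int_Inter openin_dual_topology)
    moreover have "\<gamma> ` (T closure_of fst p) \<subseteq> fst (snd p) \<and> \<eta> ` (T closure_of fst p) \<subseteq> snd (snd p)"
      if "p \<in> F" for p
      using subsetD[OF F(1) that] by (simp add: R_def case_prod_beta)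
    then have "\<gamma> \<in> P" "\<eta> \<in> Q"
      unfolding P_def Q_def topspace_dual using ch by (simp_all add: case_prod_beta)
    moreover have "P \<times> Q \<subseteq> ?f -` ?N K U \<inter> topspace (prod_topology DT DT)"
    proof (rule subsetI, clarify)
      fix \<alpha> \<beta> assume \<alpha>: "\<alpha> \<in> P" and \<beta>: "\<beta> \<in> Q"
      have top: "(\<alpha>, \<beta>) \<in> topspace (prod_topology DT DT)" using \<alpha> \<beta> by (simp add: P_def Q_def)
      have \<beta>c: "\<beta> \<in> characters G T" using \<beta> by (simp add: Q_def topspace_dual)
      have "(\<alpha> \<otimes>\<^bsub>D\<^esub> inv\<^bsub>D\<^esub> \<beta>) y \<in> U" if y: "y \<in> K" for y
      proof -
        obtain V A B where x: "(V, A, B) \<in> F" "y \<in> V" using \<F>(3) F(3) y by auto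
        have R: "(V, A, B) \<in> R" using x F(1) by blast
        then have "V \<subseteq> T closure_of V"
          by (intro closure_of_subset openin_subset) (simp add: R_def)
        with x have yV: "y \<in> T closure_of V" by blast
        have "\<alpha> \<in> ?N (T closure_of V) A" "\<beta> \<in> ?N (T closure_of V) B"
          using INT_D[OF IntD2[OF \<alpha>[unfolded P_def]] x(1)] INT_D[OF IntD2[OF \<beta>[unfolded Q_def]] x(1)]
          by simp_all
        with yV have "\<alpha> y \<in> A" "\<beta> y \<in> B" by blast+
        with R have "\<alpha> y * cnj (\<beta> y) \<in> U" by (simp add: R_def)
        then show ?thesis using \<beta>c y Kc by (simp add: f_apply subset_iff)
      qed
      moreover have "?f (\<alpha>, \<beta>) \<in> characters G T" using f top by blast
      ultimately show "(\<alpha>, \<beta>) \<in> ?f -` ?N K U \<inter> topspace (prod_topology DT DT)"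
        using top by auto
    qed
    ultimately show "\<exists>P Q. openin DT P \<and> openin DT Q \<and> \<gamma> \<in> P \<and> \<eta> \<in> Q \<and>
        P \<times> Q \<subseteq> ?f -` ?N K U \<inter> topspace (prod_topology DT DT)"
      by (intro exI[of _ P] exI[of _ Q]) simp
  qed
  moreover have "?f ` topspace (prod_topology DT DT) \<subseteq>
      \<Union>{{\<gamma> \<in> characters G T. \<gamma> ` K \<subseteq> U} |K U. compactin T K \<and> open U}"
    using f topspace_dual unfolding dual_topology_def topology_generated_by_topspace by simp
  ultimately show ?thesis
    unfolding dual_topology_def
    by (intro continuous_on_generated_topo) (auto simp flip: dual_topology_def)
qed

lemma continuous_map_quotient: "continuous_map (prod_topology T T) T (\<lambda>(x, y). x \<otimes> inv y)"
proof -
  have "continuous_map (prod_topology T T) (prod_topology T T) (\<lambda>(x, y). (x, inv y))"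
    using continuous_inv by (simp add: continuous_map_prod_top)
  then have "continuous_map (prod_topology T T) T ((\<lambda>(x, y). x \<otimes> y) \<circ> (\<lambda>(x, y). (x, inv y)))"
    using continuous_mult by (rule continuous_map_compose)
  then show ?thesis by (simp add: comp_def case_prod_unfold)
qed

lemma comm_group_tf: "comm_group (tf_group G T)"
proof -
  interpret D: comm_group D by (rule comm_group_dual)
  interpret H: group "tf_group G T" by (rule DirProd_group) (rule is_group, rule D.is_group)
  show ?thesis by (rule H.group_comm_groupI) (auto simp: m_comm D.m_comm)
qed

lemma topspace_tf: "topspace (tf_topology G T) = carrier (tf_group G T)"
  by (simp add: topspace_eq topspace_dual carrier_dual)

lemma continuous_map_tf:
  defines "H \<equiv> tf_group G T" and "X \<equiv> tf_topology G T"
  shows "continuous_map (prod_topology X X) X (\<lambda>(x, y). x \<otimes>\<^bsub>H\<^esub> inv\<^bsub>H\<^esub> y)"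
proof -
  interpret D: comm_group D by (rule comm_group_dual)
  let ?XX = "prod_topology X X"
  have proj: "continuous_map ?XX T (\<lambda>p. fst (fst p))" "continuous_map ?XX T (\<lambda>p. fst (snd p))"
    "continuous_map ?XX DT (\<lambda>p. snd (fst p))" "continuous_map ?XX DT (\<lambda>p. snd (snd p))"
    unfolding X_def
    by (auto intro: continuous_map_compose[unfolded comp_def] continuous_map_fst continuous_map_snd)
  have "continuous_map ?XX X (\<lambda>p. (fst (fst p) \<otimes> inv (fst (snd p)), snd (fst p) \<otimes>\<^bsub>D\<^esub> inv\<^bsub>D\<^esub> (snd (snd p))))"
    unfolding X_def
  proof (rule continuous_map_pairedI)
    show "continuous_map (prod_topology (tf_topology G T) (tf_topology G T)) T
        (\<lambda>p. fst (fst p) \<otimes> inv (fst (snd p)))"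
      using continuous_map_compose[OF continuous_map_pairedI[OF proj(1,2)] continuous_map_quotient]
      by (simp add: comp_def X_def)
    show "continuous_map (prod_topology (tf_topology G T) (tf_topology G T)) DT
        (\<lambda>p. snd (fst p) \<otimes>\<^bsub>D\<^esub> inv\<^bsub>D\<^esub> (snd (snd p)))"
      using continuous_map_compose[OF continuous_map_pairedI[OF proj(3,4)] continuous_map_dual]
      by (simp add: comp_def X_def)
  qed
  then show ?thesis
  proof (rule continuous_map_eq)
    fix p assume "p \<in> topspace ?XX"
    then obtain a \<gamma> b \<eta> where p: "p = ((a, \<gamma>), (b, \<eta>))" "b \<in> carrier G" "\<eta> \<in> carrier D"
      unfolding X_def by (auto simp: topspace_eq topspace_dual carrier_dual)
    then show "(fst (fst p) \<otimes> inv (fst (snd p)), snd (fst p) \<otimes>\<^bsub>D\<^esub> inv\<^bsub>D\<^esub> (snd (snd p))) =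
        (case p of (x, y) \<Rightarrow> x \<otimes>\<^bsub>H\<^esub> inv\<^bsub>H\<^esub> y)"
      unfolding H_def by (simp add: inv_DirProd[OF is_group D.is_group])
  qed
qed

end

section \<open>Square integrable functions on a second countable group\<close>

lemma measurable_cnj [measurable]: "cnj \<in> borel_measurable borel"
  by (intro borel_measurable_continuous_onI continuous_intros)

lemma ennreal_L2_norm:
  assumes "f \<in> L2 M"
  shows "(\<integral>\<^sup>+x. ennreal ((cmod (f x))\<^sup>2) \<partial>M) = ennreal ((L2_norm M f)\<^sup>2)"
  using assms by (simp add: L2_def L2_norm_def nn_integral_eq_integral)

lemma L2_I:
  assumes "f \<in> borel_measurable M" "(\<integral>\<^sup>+x. ennreal ((cmod (f x))\<^sup>2) \<partial>M) < \<infinity>"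
  shows "f \<in> L2 M"
  using assms by (auto simp: L2_def intro!: integrableI_nonneg)

lemma L2_mult_cnj_integrable:
  assumes "f \<in> L2 M" "h \<in> L2 M"
  shows "integrable M (\<lambda>x. f x * cnj (h x))"
proof (rule Bochner_Integration.integrable_bound)
  show "integrable M (\<lambda>x. (cmod (f x))\<^sup>2 + (cmod (h x))\<^sup>2)"
    using assms by (simp add: L2_def)
  show "(\<lambda>x. f x * cnj (h x)) \<in> borel_measurable M"
  proof -
    have [measurable]: "f \<in> borel_measurable M" "h \<in> borel_measurable M"
      using assms by (simp_all add: L2_def)
    show ?thesis by measurable
  qed
  have "a * b \<le> a\<^sup>2 + b\<^sup>2" if "0 \<le> a" "0 \<le> b" for a b :: real
    using sum_squares_bound[of a b] mult_nonneg_nonneg[OF that] by (simp add: mult.assoc)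
  then show "AE x in M. norm (f x * cnj (h x)) \<le> norm ((cmod (f x))\<^sup>2 + (cmod (h x))\<^sup>2)"
    by (simp add: norm_mult)
qed

locale lca_haar = lca_group G T for G (structure) and T :: "'a topology" +
  fixes m :: "'a measure"
  assumes second_countable: "second_countable T"
    and haar: "haar_measure G T m"
begin

lemma space_m: "space m = carrier G"
  using haar_measure_space[OF haar] topspace_eq by simp

lemma sets_m [measurable_cong]: "sets m = sets (borel_of T)"
  by (rule haar_measure_sets[OF haar])

lemma emeasure_basis_finite:
  assumes "openin T V" "compactin T (T closure_of V)"
  shows "emeasure m V < \<infinity>"
proof -
  have "T closure_of V \<in> sets m" by (simp add: sets_m closedin_sets_borel_of)
  then have "emeasure m V \<le> emeasure m (T closure_of V)"
    using closure_of_subset[OF openin_subset[OF assms(1)]] by (intro emeasure_mono)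
  also have "\<dots> < \<infinity>" by (rule haar_measure_compact_finite[OF haar assms(2)])
  finally show ?thesis .
qed

lemma sigma_finite_m: "sigma_finite_measure m"
proof
  obtain \<B> where \<B>: "countable \<B> \<and> (\<forall>V\<in>\<B>. openin T V \<and> compactin T (T closure_of V)) \<and>
      (\<forall>U x. openin T U \<and> x \<in> U \<longrightarrow> (\<exists>V\<in>\<B>. x \<in> V \<and> T closure_of V \<subseteq> U))"
    using countable_compact_closure_basis[OF second_countable] ..
  show "\<exists>A. countable A \<and> A \<subseteq> sets m \<and> \<Union>A = space m \<and> (\<forall>a\<in>A. emeasure m a \<noteq> \<infinity>)"
  proof (intro exI conjI ballI)
    show "countable \<B>" using \<B> by simp
    show "\<B> \<subseteq> sets m" using \<B> by (auto simp: sets_m openin_sets_borel_of)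
    show "\<Union>\<B> = space m"
      unfolding space_m topspace_eq[symmetric]
    proof (intro subset_antisym subsetI)
      fix x assume "x \<in> topspace T"
      then have "\<exists>V\<in>\<B>. x \<in> V \<and> T closure_of V \<subseteq> topspace T" using \<B> by simp
      then show "x \<in> \<Union>\<B>" by blast
    next
      fix x assume "x \<in> \<Union>\<B>"
      then show "x \<in> topspace T" using \<B> openin_subset[of T] by blast
    qed
    fix V assume "V \<in> \<B>"
    then show "emeasure m V \<noteq> \<infinity>" using emeasure_basis_finite \<B> by (simp add: less_top)
  qed
qed

lemma compact_set_finite_positive:
  obtains K where "compactin T K" "K \<in> sets m" "0 < emeasure m K" "emeasure m K < \<infinity>"
proof -
  have "0 < emeasure m (space m)" using haar by (simp add: haar_measure_def zero_less_iff_neq_zero)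
  then obtain K where "compactin T K" "K \<in> sets m" "0 < emeasure m K"
    using haar_measure_compact_approx[OF haar] by blast
  moreover from this have "emeasure m K < \<infinity>" using haar_measure_compact_finite[OF haar] by simp
  ultimately show ?thesis by (rule that)
qed

lemma continuous_map_measurable_pair:
  assumes "continuous_map (prod_topology T T) T f"
  shows "f \<in> m \<Otimes>\<^sub>M m \<rightarrow>\<^sub>M m"
proof -
  have "f \<in> borel_of T \<Otimes>\<^sub>M borel_of T \<rightarrow>\<^sub>M borel_of T"
    using measurable_compose[OF id_measurable_prod_borel_of[OF second_countable second_countable]
      continuous_map_measurable[OF assms]] .
  moreover have "sets (m \<Otimes>\<^sub>M m) = sets (borel_of T \<Otimes>\<^sub>M borel_of T)"
    by (intro sets_pair_measure_cong sets_m)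
  ultimately show ?thesis using measurable_cong_sets sets_m by blast
qed

lemma measurable_group_mult: "(\<lambda>(x, y). x \<otimes> y) \<in> m \<Otimes>\<^sub>M m \<rightarrow>\<^sub>M m"
  by (rule continuous_map_measurable_pair[OF continuous_mult])

lemma measurable_quotient: "(\<lambda>(x, y). x \<otimes> inv y) \<in> m \<Otimes>\<^sub>M m \<rightarrow>\<^sub>M m"
  by (rule continuous_map_measurable_pair[OF continuous_map_quotient])

lemma measurable_translation [measurable]:
  assumes "l \<in> carrier G"
  shows "(\<lambda>x. l \<otimes> x) \<in> m \<rightarrow>\<^sub>M m"
proof -
  have "continuous_map T T ((\<lambda>(x, y). x \<otimes> y) \<circ> (\<lambda>x. (l, x)))"
    by (intro continuous_map_compose[OF _ continuous_mult] continuous_map_pairedI)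
      (use assms topspace_eq in auto)
  then have "(\<lambda>x. l \<otimes> x) \<in> borel_of T \<rightarrow>\<^sub>M borel_of T"
    by (intro continuous_map_measurable) (simp add: comp_def)
  then show ?thesis using measurable_cong_sets[OF sets_m sets_m] by simp
qed

lemma distr_translation:
  assumes l: "l \<in> carrier G"
  shows "distr m m (\<lambda>x. l \<otimes> x) = m"
proof (rule measure_eqI)
  fix E assume "E \<in> sets (distr m m (\<lambda>x. l \<otimes> x))"
  then have E: "E \<in> sets m" by simp
  then have Ec: "E \<subseteq> carrier G" using sets.sets_into_space space_m by blast
  have "(\<lambda>x. l \<otimes> x) -` E \<inter> space m = inv l <#\<^bsub>G\<^esub> E"
  proof (intro subset_antisym subsetI)
    fix x assume "x \<in> (\<lambda>x. l \<otimes> x) -` E \<inter> space m"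
    then have "l \<otimes> x \<in> E" "x = inv l \<otimes> (l \<otimes> x)"
      using l by (auto simp: space_m m_assoc[symmetric])
    then show "x \<in> inv l <#\<^bsub>G\<^esub> E" unfolding l_coset_def by blast
  next
    fix x assume "x \<in> inv l <#\<^bsub>G\<^esub> E"
    then obtain y where "y \<in> E" "x = inv l \<otimes> y" by (auto simp: l_coset_def)
    then show "x \<in> (\<lambda>x. l \<otimes> x) -` E \<inter> space m"
      using l Ec by (auto simp: space_m m_assoc[symmetric])
  qed
  then show "emeasure (distr m m (\<lambda>x. l \<otimes> x)) E = emeasure m E"
    using E haar l by (simp add: emeasure_distr measurable_translation haar_measure_def)
qed simp

lemma nn_integral_translation:
  assumes "l \<in> carrier G" "f \<in> borel_measurable m"
  shows "(\<integral>\<^sup>+x. f (l \<otimes> x) \<partial>m) = (\<integral>\<^sup>+x. f x \<partial>m)"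
  using nn_integral_distr[of "\<lambda>x. l \<otimes> x" m m f] assms
  by (simp add: measurable_translation distr_translation)

lemma integral_translation:
  fixes f :: "'a \<Rightarrow> complex"
  assumes "l \<in> carrier G" "f \<in> borel_measurable m"
  shows "(\<integral>x. f (l \<otimes> x) \<partial>m) = (\<integral>x. f x \<partial>m)"
  using integral_distr[of "\<lambda>x. l \<otimes> x" m m f] assms
  by (simp add: measurable_translation distr_translation)

lemma measurable_character:
  assumes "\<gamma> \<in> characters G T"
  shows "\<gamma> \<in> borel_measurable m"
  using continuous_map_borel_measurable[OF character_continuous[OF assms]]
    measurable_cong_sets[OF sets_m refl] by blast

lemma right_translation_L2:
  assumes l: "l \<in> carrier G" and g: "g \<in> L2 m"
  shows "(\<lambda>x. g (x \<otimes> inv l)) \<in> L2 m" "L2_norm m (\<lambda>x. g (x \<otimes> inv l)) = L2_norm m g"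
proof -
  have g': "g \<in> borel_measurable m" using g by (simp add: L2_def)
  have comm: "g (x \<otimes> inv l) = g (inv l \<otimes> x)" if "x \<in> space m" for x
    using that l by (simp add: space_m m_comm)
  have "(\<lambda>x. g (inv l \<otimes> x)) \<in> borel_measurable m"
    using measurable_compose[OF measurable_translation g'] l by simp
  then have meas: "(\<lambda>x. g (x \<otimes> inv l)) \<in> borel_measurable m"
    using comm by (simp cong: measurable_cong)
  have g2: "(\<lambda>x. ennreal ((cmod (g x))\<^sup>2)) \<in> borel_measurable m" using g' by measurable
  have "(\<integral>\<^sup>+x. ennreal ((cmod (g (x \<otimes> inv l)))\<^sup>2) \<partial>m) = (\<integral>\<^sup>+x. ennreal ((cmod (g (inv l \<otimes> x)))\<^sup>2) \<partial>m)"
    by (intro nn_integral_cong) (simp add: comm)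
  also have "\<dots> = (\<integral>\<^sup>+x. ennreal ((cmod (g x))\<^sup>2) \<partial>m)"
    using nn_integral_translation[OF _ g2, of "inv l"] l by simp
  finally have eq: "(\<integral>\<^sup>+x. ennreal ((cmod (g (x \<otimes> inv l)))\<^sup>2) \<partial>m) = (\<integral>\<^sup>+x. ennreal ((cmod (g x))\<^sup>2) \<partial>m)" .
  show *: "(\<lambda>x. g (x \<otimes> inv l)) \<in> L2 m"
    using meas g by (intro L2_I) (simp_all add: eq ennreal_L2_norm)
  from eq have "ennreal ((L2_norm m (\<lambda>x. g (x \<otimes> inv l)))\<^sup>2) = ennreal ((L2_norm m g)\<^sup>2)"
    by (simp add: ennreal_L2_norm * g)
  then show "L2_norm m (\<lambda>x. g (x \<otimes> inv l)) = L2_norm m g"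
    by (simp add: L2_norm_def)
qed

text \<open>Substituting \<open>l x\<close> for \<open>x\<close> moves the translation from \<open>g\<close> to \<open>f\<close>; after exchanging the
  integrals, translation invariance evaluates the inner one as \<open>\<parallel>f\<parallel>\<^sup>2 |g x|\<^sup>2\<close>.\<close>

lemma nn_integral_correlation:
  assumes f: "f \<in> L2 m" and g: "g \<in> L2 m"
  shows "(\<integral>\<^sup>+l. \<integral>\<^sup>+x. ennreal ((cmod (f x * cnj (g (x \<otimes> inv l))))\<^sup>2) \<partial>m \<partial>m) =
    ennreal ((L2_norm m f)\<^sup>2 * (L2_norm m g)\<^sup>2)"
proof -
  interpret sigma_finite_measure m by (rule sigma_finite_m)
  interpret pair_sigma_finite m m ..
  define F where "F x = ennreal ((cmod (f x))\<^sup>2)" for x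
  define H where "H x = ennreal ((cmod (g x))\<^sup>2)" for x
  have [measurable]: "f \<in> borel_measurable m" "g \<in> borel_measurable m"
    using f g by (simp_all add: L2_def)
  have F [measurable]: "F \<in> borel_measurable m" and H [measurable]: "H \<in> borel_measurable m"
    unfolding F_def H_def by measurable
  have Fl: "(\<lambda>(l, x). F (l \<otimes> x)) \<in> borel_measurable (m \<Otimes>\<^sub>M m)"
    using measurable_compose[OF measurable_group_mult F] by (simp add: case_prod_beta)
  have "(\<integral>\<^sup>+l. \<integral>\<^sup>+x. ennreal ((cmod (f x * cnj (g (x \<otimes> inv l))))\<^sup>2) \<partial>m \<partial>m) =
      (\<integral>\<^sup>+l. \<integral>\<^sup>+x. F (l \<otimes> x) * H x \<partial>m \<partial>m)"
  proof (rule nn_integral_cong)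
    fix l assume "l \<in> space m"
    then have l: "l \<in> carrier G" by (simp add: space_m)
    have Hl: "(\<lambda>x. H (x \<otimes> inv l)) \<in> borel_measurable m"
    proof -
      have k: "(\<lambda>x. g (x \<otimes> inv l)) \<in> borel_measurable m"
        using right_translation_L2(1)[OF l g] by (simp add: L2_def)
      have "(\<lambda>z :: complex. ennreal ((cmod z)\<^sup>2)) \<in> borel_measurable borel" by measurable
      then show ?thesis unfolding H_def by (rule measurable_compose[OF k])
    qed
    have "(\<integral>\<^sup>+x. ennreal ((cmod (f x * cnj (g (x \<otimes> inv l))))\<^sup>2) \<partial>m) =
        (\<integral>\<^sup>+x. F x * H (x \<otimes> inv l) \<partial>m)"
      by (simp add: F_def H_def norm_mult power_mult_distrib ennreal_mult)
    also have "\<dots> = (\<integral>\<^sup>+x. F (l \<otimes> x) * H ((l \<otimes> x) \<otimes> inv l) \<partial>m)"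
      using nn_integral_translation[OF l, of "\<lambda>x. F x * H (x \<otimes> inv l)"] F Hl by simp
    also have "\<dots> = (\<integral>\<^sup>+x. F (l \<otimes> x) * H x \<partial>m)"
    proof (rule nn_integral_cong)
      fix x assume "x \<in> space m"
      then have "l \<otimes> x \<otimes> inv l = x"
        using l m_comm[of "l \<otimes> x" "inv l"] by (simp add: space_m flip: m_assoc)
      then show "F (l \<otimes> x) * H (l \<otimes> x \<otimes> inv l) = F (l \<otimes> x) * H x" by simp
    qed
    finally show "(\<integral>\<^sup>+x. ennreal ((cmod (f x * cnj (g (x \<otimes> inv l))))\<^sup>2) \<partial>m) =
        (\<integral>\<^sup>+x. F (l \<otimes> x) * H x \<partial>m)" .
  qed
  also have "\<dots> = (\<integral>\<^sup>+x. \<integral>\<^sup>+l. F (l \<otimes> x) * H x \<partial>m \<partial>m)"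
    by (rule Fubini'[symmetric]) (use Fl in \<open>simp add: case_prod_beta\<close>)
  also have "\<dots> = (\<integral>\<^sup>+x. ennreal ((L2_norm m f)\<^sup>2) * H x \<partial>m)"
  proof (rule nn_integral_cong)
    fix x assume "x \<in> space m"
    then have x: "x \<in> carrier G" by (simp add: space_m)
    have Fx: "(\<lambda>l. F (x \<otimes> l)) \<in> borel_measurable m"
      using measurable_compose[OF measurable_translation[OF x] F] .
    have "(\<integral>\<^sup>+l. F (l \<otimes> x) * H x \<partial>m) = (\<integral>\<^sup>+l. F (x \<otimes> l) * H x \<partial>m)"
      using x by (intro nn_integral_cong) (simp add: space_m m_comm)
    also have "\<dots> = (\<integral>\<^sup>+l. F (x \<otimes> l) \<partial>m) * H x" by (rule nn_integral_multc[OF Fx])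
    also have "\<dots> = ennreal ((L2_norm m f)\<^sup>2) * H x"
      using nn_integral_translation[OF x F] ennreal_L2_norm[OF f] by (simp add: F_def)
    finally show "(\<integral>\<^sup>+l. F (l \<otimes> x) * H x \<partial>m) = ennreal ((L2_norm m f)\<^sup>2) * H x" .
  qed
  also have "\<dots> = ennreal ((L2_norm m f)\<^sup>2) * (\<integral>\<^sup>+x. H x \<partial>m)"
    by (rule nn_integral_cmult[OF H])
  also have "\<dots> = ennreal ((L2_norm m f)\<^sup>2 * (L2_norm m g)\<^sup>2)"
    using ennreal_L2_norm[OF g] by (simp add: H_def ennreal_mult)
  finally show ?thesis .
qed

lemma tf_shift_apply: "tf_shift G (l, \<gamma>) g x = \<gamma> x * g (x \<otimes> inv l)"
  by (simp add: tf_shift_def modulation_op_def translation_op_def)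

lemma tf_shift_L2:
  assumes l: "l \<in> carrier G" and \<gamma>: "\<gamma> \<in> characters G T" and g: "g \<in> L2 m"
  shows "tf_shift G (l, \<gamma>) g \<in> L2 m" "L2_norm m (tf_shift G (l, \<gamma>) g) = L2_norm m g"
proof -
  have eq: "cmod (tf_shift G (l, \<gamma>) g x) = cmod (g (x \<otimes> inv l))" if "x \<in> space m" for x
    using that character_norm[OF \<gamma>] by (simp add: tf_shift_apply norm_mult space_m)
  note T = right_translation_L2[OF l g]
  have [measurable]: "\<gamma> \<in> borel_measurable m" "(\<lambda>x. g (x \<otimes> inv l)) \<in> borel_measurable m"
    using measurable_character[OF \<gamma>] T(1) by (simp_all add: L2_def)
  have "tf_shift G (l, \<gamma>) g \<in> borel_measurable m"
    unfolding tf_shift_apply[abs_def] by measurable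
  moreover have "integrable m (\<lambda>x. (cmod (tf_shift G (l, \<gamma>) g x))\<^sup>2)"
    using T(1) by (simp add: L2_def eq cong: Bochner_Integration.integrable_cong)
  ultimately show "tf_shift G (l, \<gamma>) g \<in> L2 m" by (simp add: L2_def)
  show "L2_norm m (tf_shift G (l, \<gamma>) g) = L2_norm m g"
    using T(2) by (simp add: L2_norm_def eq cong: Bochner_Integration.integral_cong)
qed

text \<open>For a fixed translation, the inner products with all modulations form a Fourier transform,
  which brings Plancherel's theorem into play.\<close>

lemma L2_inner_tf_shift_eq_fourier:
  "L2_inner m f (tf_shift G (l, \<gamma>) g) = fourier m (\<lambda>x. f x * cnj (g (x \<otimes> inv l))) \<gamma>"
  by (simp add: L2_inner_def fourier_def tf_shift_apply mult_ac)

text \<open>Up to a factor of modulus one, \<open>\<pi>(z \<nu>) = \<pi>(z) \<pi>(\<nu>)\<close>, and the function on the right is, again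
  up to such a factor, \<open>\<pi>(z)\<^sup>* f\<close>.\<close>

lemma cmod_L2_inner_tf_shift_mult:
  assumes f: "f \<in> borel_measurable m" and g: "g \<in> borel_measurable m"
    and z: "l \<in> carrier G" "\<gamma> \<in> characters G T" and \<nu>: "k \<in> carrier G" "\<eta> \<in> characters G T"
  shows "cmod (L2_inner m f (tf_shift G ((l, \<gamma>) \<otimes>\<^bsub>tf_group G T\<^esub> (k, \<eta>)) g)) =
    cmod (L2_inner m (\<lambda>x. f (l \<otimes> x) * cnj (\<gamma> x)) (tf_shift G (k, \<eta>) g))"
proof -
  have lk: "l \<otimes> k \<in> carrier G" using z \<nu> by simp
  have meas: "(\<lambda>x. f x * cnj (\<gamma> x * \<eta> x * g (x \<otimes> inv (l \<otimes> k)))) \<in> borel_measurable m"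
  proof -
    have "(\<lambda>x. g (inv (l \<otimes> k) \<otimes> x)) \<in> borel_measurable m"
      using measurable_compose[OF measurable_translation g] lk by simp
    moreover have "g (inv (l \<otimes> k) \<otimes> x) = g (x \<otimes> inv (l \<otimes> k))" if "x \<in> space m" for x
      using that lk by (simp add: space_m m_comm del: inv_mult_group)
    ultimately have [measurable]: "(\<lambda>x. g (x \<otimes> inv (l \<otimes> k))) \<in> borel_measurable m"
      by (simp cong: measurable_cong del: inv_mult_group)
    note [measurable] = f measurable_character[OF z(2)] measurable_character[OF \<nu>(2)]
    show ?thesis by measurable
  qed
  have "L2_inner m f (tf_shift G ((l, \<gamma>) \<otimes>\<^bsub>tf_group G T\<^esub> (k, \<eta>)) g) =
      (\<integral>x. f x * cnj (\<gamma> x * \<eta> x * g (x \<otimes> inv (l \<otimes> k))) \<partial>m)"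
    unfolding L2_inner_def mult_DirProd tf_shift_apply
    by (intro Bochner_Integration.integral_cong refl) (simp add: space_m mult_dual_apply)
  also have "\<dots> = (\<integral>x. f (l \<otimes> x) * cnj (\<gamma> (l \<otimes> x) * \<eta> (l \<otimes> x) * g ((l \<otimes> x) \<otimes> inv (l \<otimes> k))) \<partial>m)"
    by (rule integral_translation[OF z(1) meas, symmetric])
  also have "\<dots> = (\<integral>x. cnj (\<gamma> l * \<eta> l) * ((f (l \<otimes> x) * cnj (\<gamma> x)) * cnj (tf_shift G (k, \<eta>) g x)) \<partial>m)"
  proof (intro Bochner_Integration.integral_cong refl)
    fix x assume "x \<in> space m"
    then have x: "x \<in> carrier G" by (simp add: space_m)
    have "(l \<otimes> x) \<otimes> inv (l \<otimes> k) = x \<otimes> inv k"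
    proof -
      have "(l \<otimes> x) \<otimes> inv (l \<otimes> k) = (x \<otimes> l) \<otimes> (inv l \<otimes> inv k)"
        using x z(1) \<nu>(1) by (simp add: inv_mult m_comm)
      also have "\<dots> = x \<otimes> inv k" using x z(1) \<nu>(1) by (simp add: m_assoc[symmetric]) (simp add: m_assoc)
      finally show ?thesis .
    qed
    then show "f (l \<otimes> x) * cnj (\<gamma> (l \<otimes> x) * \<eta> (l \<otimes> x) * g ((l \<otimes> x) \<otimes> inv (l \<otimes> k))) =
        cnj (\<gamma> l * \<eta> l) * ((f (l \<otimes> x) * cnj (\<gamma> x)) * cnj (tf_shift G (k, \<eta>) g x))"
      using x z \<nu> by (simp add: tf_shift_apply character_mult mult_ac del: inv_mult_group)
  qed
  also have "\<dots> = cnj (\<gamma> l * \<eta> l) * L2_inner m (\<lambda>x. f (l \<otimes> x) * cnj (\<gamma> x)) (tf_shift G (k, \<eta>) g)"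
    unfolding L2_inner_def by simp
  finally show ?thesis
    using z \<nu> by (simp add: norm_mult character_norm)
qed

lemma L2_tf_shift_adjoint:
  assumes l: "l \<in> carrier G" and \<gamma>: "\<gamma> \<in> characters G T" and f: "f \<in> L2 m"
  shows "(\<lambda>x. f (l \<otimes> x) * cnj (\<gamma> x)) \<in> L2 m" (is "?h \<in> _")
    and "L2_norm m (\<lambda>x. f (l \<otimes> x) * cnj (\<gamma> x)) = L2_norm m f"
proof -
  have fm: "f \<in> borel_measurable m" using f by (simp add: L2_def)
  have [measurable]: "(\<lambda>x. f (l \<otimes> x)) \<in> borel_measurable m" "\<gamma> \<in> borel_measurable m"
    using measurable_compose[OF measurable_translation[OF l] fm] measurable_character[OF \<gamma>] by simp_all
  have meas: "?h \<in> borel_measurable m" by measurable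
  have f2: "(\<lambda>x. ennreal ((cmod (f x))\<^sup>2)) \<in> borel_measurable m" using fm by measurable
  have "(\<integral>\<^sup>+x. ennreal ((cmod (?h x))\<^sup>2) \<partial>m) = (\<integral>\<^sup>+x. ennreal ((cmod (f (l \<otimes> x)))\<^sup>2) \<partial>m)"
    by (intro nn_integral_cong) (simp add: norm_mult space_m character_norm[OF \<gamma>])
  also have "\<dots> = (\<integral>\<^sup>+x. ennreal ((cmod (f x))\<^sup>2) \<partial>m)"
    by (rule nn_integral_translation[OF l f2])
  finally have eq: "(\<integral>\<^sup>+x. ennreal ((cmod (?h x))\<^sup>2) \<partial>m) = (\<integral>\<^sup>+x. ennreal ((cmod (f x))\<^sup>2) \<partial>m)" .
  show *: "?h \<in> L2 m"
    using meas f by (intro L2_I) (simp_all add: eq ennreal_L2_norm)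
  from eq have "ennreal ((L2_norm m ?h)\<^sup>2) = ennreal ((L2_norm m f)\<^sup>2)"
    by (simp add: ennreal_L2_norm * f)
  then show "L2_norm m ?h = L2_norm m f"
    by (simp add: L2_norm_def)
qed

end

section \<open>Plancherel's theorem and the orthogonality relation\<close>

locale lca_plancherel = lca_haar G T m for G (structure) and T :: "'a topology" and m +
  fixes m' :: "('a \<Rightarrow> complex) measure"
  assumes dual: "dual_haar_measure G T m m'"
begin

lemma haar_dual: "haar_measure D DT m'"
  using dual by (simp add: dual_haar_measure_def)

lemma space_dual: "space m' = characters G T"
  using haar_measure_space[OF haar_dual] topspace_dual by simp

lemma sets_dual: "sets m' = sets (borel_of DT)"
  by (rule haar_measure_sets[OF haar_dual])

text \<open>Evaluation is continuous since \<open>G\<close> is locally compact. The sets \<open>V \<times> {\<gamma>. \<gamma> (closure V) \<subseteq> S}\<close>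
  with \<open>V\<close> in a countable basis exhaust the preimage of an open set \<open>S\<close>.\<close>

lemma measurable_evaluation: "(\<lambda>(x, \<gamma>). \<gamma> x) \<in> borel_measurable (m \<Otimes>\<^sub>M m')"
proof (rule borel_measurableI)
  obtain \<B> where \<B>: "countable \<B> \<and> (\<forall>V\<in>\<B>. openin T V \<and> compactin T (T closure_of V)) \<and>
      (\<forall>U x. openin T U \<and> x \<in> U \<longrightarrow> (\<exists>V\<in>\<B>. x \<in> V \<and> T closure_of V \<subseteq> U))"
    using countable_compact_closure_basis[OF second_countable] ..
  fix S :: "complex set" assume S: "open S"
  let ?N = "\<lambda>V. {\<gamma> \<in> characters G T. \<gamma> ` (T closure_of V) \<subseteq> S}"
  have "(\<lambda>(x, \<gamma>). \<gamma> x) -` S \<inter> space (m \<Otimes>\<^sub>M m') = (\<Union>V\<in>\<B>. V \<times> ?N V)"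
  proof (intro subset_antisym subsetI)
    fix p assume p: "p \<in> (\<lambda>(x, \<gamma>). \<gamma> x) -` S \<inter> space (m \<Otimes>\<^sub>M m')"
    obtain x \<gamma> where x\<gamma>: "p = (x, \<gamma>)" by (cases p)
    have *: "x \<in> carrier G" "\<gamma> \<in> characters G T" "\<gamma> x \<in> S"
      using p by (simp_all add: x\<gamma> space_pair_measure space_m space_dual)
    have "openin T {y \<in> topspace T. \<gamma> y \<in> S}"
      using character_continuous[OF *(2)] S by (simp add: continuous_map_def)
    then have "\<exists>V\<in>\<B>. x \<in> V \<and> T closure_of V \<subseteq> {y \<in> topspace T. \<gamma> y \<in> S}"
      using \<B> *(1,3) by (simp add: topspace_eq)
    then obtain V where V: "V \<in> \<B>" "x \<in> V" "T closure_of V \<subseteq> {y \<in> topspace T. \<gamma> y \<in> S}"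
      by blast
    then have "\<gamma> \<in> ?N V" using *(2) by auto
    then show "p \<in> (\<Union>V\<in>\<B>. V \<times> ?N V)" unfolding x\<gamma> using V(1,2) by (intro UN_I[of V]) simp_all
  next
    fix p assume "p \<in> (\<Union>V\<in>\<B>. V \<times> ?N V)"
    then obtain V x \<gamma> where V: "V \<in> \<B>" "p = (x, \<gamma>)" "x \<in> V" "\<gamma> \<in> ?N V" by blast
    have "V \<subseteq> topspace T" using V(1) \<B> openin_subset by blast
    moreover from this have "V \<subseteq> T closure_of V" by (rule closure_of_subset)
    ultimately have "x \<in> carrier G" "x \<in> T closure_of V" using V(3) topspace_eq by blast+
    moreover from this have "\<gamma> x \<in> S" using V(4) by blast
    ultimately have "x \<in> carrier G" "\<gamma> x \<in> S" by simp_all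
    then show "p \<in> (\<lambda>(x, \<gamma>). \<gamma> x) -` S \<inter> space (m \<Otimes>\<^sub>M m')"
      using V by (simp add: space_pair_measure space_m space_dual)
  qed
  moreover have "V \<times> ?N V \<in> sets (m \<Otimes>\<^sub>M m')" if "V \<in> \<B>" for V
    using \<B> that S
    by (intro pair_measureI) (simp_all add: sets_m sets_dual openin_sets_borel_of openin_dual_topology)
  then have "(\<Union>V\<in>\<B>. V \<times> ?N V) \<in> sets (m \<Otimes>\<^sub>M m')"
    using \<B> by (intro sets.countable_UN') auto
  ultimately show "(\<lambda>(x, \<gamma>). \<gamma> x) -` S \<inter> space (m \<Otimes>\<^sub>M m') \<in> sets (m \<Otimes>\<^sub>M m')"
    by simp
qed

lemma plancherel:
  assumes "integrable m f" "f \<in> L2 m"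
  shows "fourier m f \<in> L2 m'"
    and "(\<integral>\<^sup>+\<gamma>. ennreal ((cmod (fourier m f \<gamma>))\<^sup>2) \<partial>m') = (\<integral>\<^sup>+x. ennreal ((cmod (f x))\<^sup>2) \<partial>m)"
  using dual assms by (simp_all add: dual_haar_measure_def ennreal_L2_norm)

text \<open>If \<open>\<gamma>\<close> stays within distance \<open>1/2\<close> of a number \<open>c\<close> of modulus one on \<open>W\<close>, then the integral of
  \<open>cnj \<gamma>\<close> over \<open>W\<close> differs from that of \<open>cnj c\<close>, whose modulus is the measure of \<open>W\<close>, by at most half
  of it.\<close>

lemma fourier_indicator_nonzero:
  assumes \<gamma>: "\<gamma> \<in> characters G T" and W: "W \<in> sets m" "0 < emeasure m W" "emeasure m W < \<infinity>"
    and c: "cmod c = 1" "\<And>x. x \<in> W \<Longrightarrow> dist c (\<gamma> x) < 1 / 2"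
  shows "fourier m (\<lambda>x. indicator W x *\<^sub>R 1) \<gamma> \<noteq> 0"
proof
  assume "fourier m (\<lambda>x. indicator W x *\<^sub>R 1) \<gamma> = 0"
  then have zero: "(\<integral>x. indicator W x *\<^sub>R cnj (\<gamma> x) \<partial>m) = 0"
    by (simp add: fourier_def)
  have pos: "0 < measure m W"
    using W(2,3) by (simp add: measure_def enn2real_positive_iff)
  have Wc: "W \<subseteq> carrier G" using sets.sets_into_space[OF W(1)] space_m by simp
  have int1: "integrable m (\<lambda>x. indicator W x *\<^sub>R cnj (\<gamma> x))"
  proof (rule Bochner_Integration.integrable_bound)
    show "integrable m (\<lambda>x. indicator W x :: real)" using W by simp
    show "(\<lambda>x. indicator W x *\<^sub>R cnj (\<gamma> x)) \<in> borel_measurable m"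
      using W(1) measurable_character[OF \<gamma>] by measurable
    show "AE x in m. norm (indicator W x *\<^sub>R cnj (\<gamma> x)) \<le> norm (indicator W x :: real)"
      using Wc by (intro AE_I2) (auto simp: indicator_def character_norm[OF \<gamma>])
  qed
  have int2: "integrable m (\<lambda>x. indicator W x *\<^sub>R cnj c)"
    using has_bochner_integral_indicator[OF W(1,3), of "cnj c"] by (rule integrable.intros)
  have "(\<integral>x. indicator W x *\<^sub>R (cnj c - cnj (\<gamma> x)) \<partial>m) = measure m W *\<^sub>R cnj c"
    using int1 int2 zero has_bochner_integral_integral_eq[OF has_bochner_integral_indicator[OF W(1,3), of "cnj c"]]
    by (simp add: scaleR_diff_right)
  then have "measure m W = norm (\<integral>x. indicator W x *\<^sub>R (cnj c - cnj (\<gamma> x)) \<partial>m)"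
    using c by simp
  also have "\<dots> \<le> (\<integral>x. norm (indicator W x *\<^sub>R (cnj c - cnj (\<gamma> x))) \<partial>m)"
    by (rule integral_norm_bound)
  also have "\<dots> \<le> (\<integral>x. indicator W x * (1 / 2) \<partial>m)"
  proof (rule integral_mono)
    show "integrable m (\<lambda>x. norm (indicator W x *\<^sub>R (cnj c - cnj (\<gamma> x))))"
      using int1 int2 by (intro integrable_norm) (simp add: scaleR_diff_right)
    show "integrable m (\<lambda>x. indicator W x * (1 / 2) :: real)" using W by simp
    fix x
    have "norm (cnj c - cnj (\<gamma> x)) = dist c (\<gamma> x)"
      by (metis complex_cnj_diff complex_mod_cnj dist_norm)
    then show "norm (indicator W x *\<^sub>R (cnj c - cnj (\<gamma> x))) \<le> indicator W x * (1 / 2)"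
      using c(2)[of x] by (auto simp: indicator_def)
  qed
  also have "\<dots> = measure m W / 2" using W by simp
  finally show False using pos by simp
qed

text \<open>Let \<open>V\<close> range over a countable basis of sets with compact closure and let \<open>u V\<close> be the squared
  modulus of the Fourier transform of the indicator of \<open>V\<close>. It is integrable by Plancherel's theorem,
  so Markov's inequality makes the sets \<open>{\<gamma>. 1 \<le> n \<cdot> u V \<gamma>}\<close> have finite measure. They cover the dual
  group: the basic sets on which \<open>\<gamma>\<close> is nearly constant cover \<open>G\<close>, so one of them has positive
  measure, and there \<open>u V \<gamma> \<noteq> 0\<close> by \<open>fourier_indicator_nonzero\<close>.\<close>

lemma sigma_finite_dual: "sigma_finite_measure m'"
proof
  obtain \<B> where \<B>: "countable \<B> \<and> (\<forall>V\<in>\<B>. openin T V \<and> compactin T (T closure_of V)) \<and>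
      (\<forall>U x. openin T U \<and> x \<in> U \<longrightarrow> (\<exists>V\<in>\<B>. x \<in> V \<and> T closure_of V \<subseteq> U))"
    using countable_compact_closure_basis[OF second_countable] ..
  have \<B>_sets: "V \<in> sets m" if "V \<in> \<B>" for V
    using \<B> that by (simp add: sets_m openin_sets_borel_of)
  have \<B>_fin: "emeasure m V < \<infinity>" if "V \<in> \<B>" for V
    using \<B> that emeasure_basis_finite by simp
  define u where "u V \<gamma> = (cmod (fourier m (\<lambda>x. indicator V x *\<^sub>R 1) \<gamma>))\<^sup>2" for V \<gamma>
  have u: "(\<lambda>\<gamma>. ennreal (u V \<gamma>)) \<in> borel_measurable m'" "(\<integral>\<^sup>+\<gamma>. ennreal (u V \<gamma>) \<partial>m') < \<infinity>"
    if "V \<in> \<B>" for V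
  proof -
    have i: "integrable m (\<lambda>x. indicator V x *\<^sub>R 1 :: complex)"
      using has_bochner_integral_indicator[OF \<B>_sets[OF that] \<B>_fin[OF that], of "1::complex"]
      by (rule integrable.intros)
    have eq: "(\<lambda>x. ennreal ((cmod (indicator V x *\<^sub>R 1))\<^sup>2)) = indicator V"
      by (auto simp: indicator_def fun_eq_iff)
    have l: "(\<lambda>x. indicator V x *\<^sub>R 1) \<in> L2 m"
      using \<B>_sets[OF that] \<B>_fin[OF that]
      by (intro L2_I borel_measurable_integrable[OF i]) (simp only: eq nn_integral_indicator)
    show "(\<integral>\<^sup>+\<gamma>. ennreal (u V \<gamma>) \<partial>m') < \<infinity>"
      unfolding u_def plancherel(2)[OF i l] eq using \<B>_sets[OF that] \<B>_fin[OF that] by simp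
    have "fourier m (\<lambda>x. indicator V x *\<^sub>R 1) \<in> borel_measurable m'"
      using plancherel(1)[OF i l] by (simp add: L2_def)
    then show "(\<lambda>\<gamma>. ennreal (u V \<gamma>)) \<in> borel_measurable m'" unfolding u_def by measurable
  qed
  define S where "S p = {\<gamma> \<in> space m'. 1 \<le> ennreal (real (snd p)) * ennreal (u (fst p) \<gamma>)}"
    for p :: "'a set \<times> nat"
  show "\<exists>A. countable A \<and> A \<subseteq> sets m' \<and> \<Union>A = space m' \<and> (\<forall>a\<in>A. emeasure m' a \<noteq> \<infinity>)"
  proof (intro exI conjI ballI)
    show "countable (S ` (\<B> \<times> UNIV))" using \<B> by (intro countable_image countable_SIGMA) auto
    have "S p \<in> sets m'" if "p \<in> \<B> \<times> UNIV" for p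
    proof -
      have [measurable]: "(\<lambda>\<gamma>. ennreal (u (fst p) \<gamma>)) \<in> borel_measurable m'"
        using that by (intro u(1)) auto
      show ?thesis unfolding S_def by measurable
    qed
    then show "S ` (\<B> \<times> UNIV) \<subseteq> sets m'" by blast
    show "emeasure m' a \<noteq> \<infinity>" if a: "a \<in> S ` (\<B> \<times> UNIV)" for a
    proof -
      obtain V n where V: "V \<in> \<B>" "a = S (V, n)" using a by force
      have "emeasure m' a = emeasure m' ({\<gamma> \<in> space m'. 1 \<le> ennreal (real n) * ennreal (u V \<gamma>)})"
        by (simp add: V S_def)
      also have "\<dots> \<le> ennreal (real n) * (\<integral>\<^sup>+\<gamma>. ennreal (u V \<gamma>) * indicator (space m') \<gamma> \<partial>m')"
        by (rule nn_integral_Markov_inequality) (use u(1)[OF V(1)] in auto)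
      also have "\<dots> = ennreal (real n) * (\<integral>\<^sup>+\<gamma>. ennreal (u V \<gamma>) \<partial>m')"
        by (intro arg_cong2[where f = "(*)"] refl nn_integral_cong) simp
      also have "\<dots> < \<infinity>" using u(2)[OF V(1)] by (simp add: ennreal_mult_less_top)
      finally show ?thesis by simp
    qed
    show "\<Union>(S ` (\<B> \<times> UNIV)) = space m'"
    proof (intro subset_antisym subsetI)
      fix \<gamma> assume "\<gamma> \<in> \<Union>(S ` (\<B> \<times> UNIV))"
      then show "\<gamma> \<in> space m'" by (auto simp: S_def)
    next
      fix \<gamma> assume \<gamma>m: "\<gamma> \<in> space m'"
      then have \<gamma>: "\<gamma> \<in> characters G T" by (simp add: space_dual)
      define \<C> where "\<C> = {V \<in> \<B>. \<exists>c. cmod c = 1 \<and> (\<forall>x\<in>V. dist c (\<gamma> x) < 1 / 2)}"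
      have "\<exists>V\<in>\<C>. emeasure m V \<noteq> 0"
      proof (rule ccontr)
        assume "\<not> (\<exists>V\<in>\<C>. emeasure m V \<noteq> 0)"
        then have "\<forall>V\<in>\<C>. emeasure m V = 0" by blast
        then have "V \<in> null_sets m" if "V \<in> \<C>" for V
          using that \<B>_sets[of V] by (intro null_setsI) (simp_all add: \<C>_def)
        moreover have "countable \<C>" unfolding \<C>_def using \<B> by (intro countable_Collect) simp
        ultimately have "\<Union>\<C> \<in> null_sets m" by (intro null_sets_UN'[of \<C> "\<lambda>x. x", simplified])
        moreover have "space m \<subseteq> \<Union>\<C>"
        proof
          fix x assume "x \<in> space m"
          then have x: "x \<in> carrier G" by (simp add: space_m)
          have "openin T {y \<in> topspace T. \<gamma> y \<in> ball (\<gamma> x) (1 / 2)}"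
            by (rule openin_continuous_map_preimage[OF character_continuous[OF \<gamma>]]) simp
          then have "\<exists>V\<in>\<B>. x \<in> V \<and> T closure_of V \<subseteq> {y \<in> topspace T. \<gamma> y \<in> ball (\<gamma> x) (1 / 2)}"
            using \<B> x by (simp add: topspace_eq)
          then obtain V where V: "V \<in> \<B>" "x \<in> V" "T closure_of V \<subseteq> {y \<in> topspace T. \<gamma> y \<in> ball (\<gamma> x) (1 / 2)}"
            by blast
          have "V \<subseteq> topspace T" using V(1) \<B> openin_subset by blast
          then have "V \<subseteq> T closure_of V" by (rule closure_of_subset)
          then have "\<forall>y\<in>V. dist (\<gamma> x) (\<gamma> y) < 1 / 2" using V(3) by auto
          then have "V \<in> \<C>" unfolding \<C>_def using V(1) character_norm[OF \<gamma> x] by auto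
          then show "x \<in> \<Union>\<C>" using V(2) by blast
        qed
        ultimately have "space m \<in> null_sets m" using null_sets_subset by blast
        then show False using haar by (simp add: haar_measure_def null_sets_def)
      qed
      then obtain V c where V: "V \<in> \<B>" "emeasure m V \<noteq> 0" "cmod c = 1" "\<forall>x\<in>V. dist c (\<gamma> x) < 1 / 2"
        unfolding \<C>_def by blast
      have "fourier m (\<lambda>x. indicator V x *\<^sub>R 1) \<gamma> \<noteq> 0"
        using V by (intro fourier_indicator_nonzero[OF \<gamma> \<B>_sets _ \<B>_fin]) (auto simp: zero_less_iff_neq_zero)
      then have "0 < u V \<gamma>" by (simp add: u_def)
      then obtain n :: nat where n: "1 < real n * u V \<gamma>"
        using ex_less_of_nat_mult by blast
      then have "1 \<le> ennreal (real n) * ennreal (u V \<gamma>)"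
        using \<open>0 < u V \<gamma>\<close> by (simp flip: ennreal_mult ennreal_1 add: ennreal_leI)
      then have "\<gamma> \<in> S (V, n)" using \<gamma>m by (simp add: S_def)
      then show "\<gamma> \<in> \<Union>(S ` (\<B> \<times> UNIV))" using V(1) by blast
    qed
  qed
qed

lemma measurable_L2_inner_tf_shift:
  assumes f [measurable]: "f \<in> borel_measurable m" and g: "g \<in> borel_measurable m"
  shows "(\<lambda>\<nu>. L2_inner m f (tf_shift G \<nu> g)) \<in> borel_measurable (m \<Otimes>\<^sub>M m')"
proof -
  interpret sigma_finite_measure m by (rule sigma_finite_m)
  have "(\<lambda>p. (snd p, snd (fst p))) \<in> (m \<Otimes>\<^sub>M m') \<Otimes>\<^sub>M m \<rightarrow>\<^sub>M m \<Otimes>\<^sub>M m'" by measurable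
  from measurable_compose[OF this measurable_evaluation]
  have [measurable]: "(\<lambda>p. snd (fst p) (snd p)) \<in> borel_measurable ((m \<Otimes>\<^sub>M m') \<Otimes>\<^sub>M m)" by simp
  have "(\<lambda>p. (snd p, fst (fst p))) \<in> (m \<Otimes>\<^sub>M m') \<Otimes>\<^sub>M m \<rightarrow>\<^sub>M m \<Otimes>\<^sub>M m" by measurable
  from measurable_compose[OF measurable_compose[OF this measurable_quotient] g]
  have [measurable]: "(\<lambda>p. g (snd p \<otimes> inv (fst (fst p)))) \<in> borel_measurable ((m \<Otimes>\<^sub>M m') \<Otimes>\<^sub>M m)"
    by simp
  have "(\<lambda>(\<nu>, x). f x * cnj (tf_shift G \<nu> g x)) \<in> borel_measurable ((m \<Otimes>\<^sub>M m') \<Otimes>\<^sub>M m)"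
    unfolding tf_shift_def modulation_op_def translation_op_def case_prod_beta by measurable
  then show ?thesis
    unfolding L2_inner_def by (rule borel_measurable_lebesgue_integral)
qed

text \<open>Plancherel's theorem applies to \<open>f \<cdot> cnj (T\<^sub>l g)\<close> only when this function is square integrable;
  since \<open>nn_integral_correlation\<close> gives a finite double integral, that is the case for almost
  every \<open>l\<close>.\<close>

lemma orthogonality_relation:
  assumes f: "f \<in> L2 m" and g: "g \<in> L2 m"
  shows "(\<integral>\<^sup>+\<nu>. ennreal ((cmod (L2_inner m f (tf_shift G \<nu> g)))\<^sup>2) \<partial>(m \<Otimes>\<^sub>M m')) =
    ennreal ((L2_norm m f)\<^sup>2 * (L2_norm m g)\<^sup>2)"
proof -
  interpret M: sigma_finite_measure m by (rule sigma_finite_m)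
  interpret M': sigma_finite_measure m' by (rule sigma_finite_dual)
  let ?P = "\<lambda>l x. f x * cnj (g (x \<otimes> inv l))"
  have fm [measurable]: "f \<in> borel_measurable m" and gm [measurable]: "g \<in> borel_measurable m"
    using f g by (simp_all add: L2_def)
  have "(\<lambda>p. (snd p, fst p)) \<in> m \<Otimes>\<^sub>M m \<rightarrow>\<^sub>M m \<Otimes>\<^sub>M m" by measurable
  from measurable_compose[OF measurable_compose[OF this measurable_quotient] gm]
  have [measurable]: "(\<lambda>p. g (snd p \<otimes> inv (fst p))) \<in> borel_measurable (m \<Otimes>\<^sub>M m)" by simp
  have "(\<lambda>(l, x). ennreal ((cmod (?P l x))\<^sup>2)) \<in> borel_measurable (m \<Otimes>\<^sub>M m)"
    unfolding case_prod_beta by measurable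
  then have N: "(\<lambda>l. \<integral>\<^sup>+x. ennreal ((cmod (?P l x))\<^sup>2) \<partial>m) \<in> borel_measurable m"
    by (rule M.borel_measurable_nn_integral)
  have "AE l in m. (\<integral>\<^sup>+x. ennreal ((cmod (?P l x))\<^sup>2) \<partial>m) \<noteq> \<infinity>"
    by (rule nn_integral_PInf_AE[OF N]) (simp add: nn_integral_correlation[OF f g])
  then have "AE l in m. (\<integral>\<^sup>+\<gamma>. ennreal ((cmod (L2_inner m f (tf_shift G (l, \<gamma>) g)))\<^sup>2) \<partial>m') =
      (\<integral>\<^sup>+x. ennreal ((cmod (?P l x))\<^sup>2) \<partial>m)"
  proof (rule AE_mp, intro AE_I2 impI)
    fix l assume "l \<in> space m" and fin: "(\<integral>\<^sup>+x. ennreal ((cmod (?P l x))\<^sup>2) \<partial>m) \<noteq> \<infinity>"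
    then have l: "l \<in> carrier G" by (simp add: space_m)
    have int: "integrable m (?P l)"
      by (rule L2_mult_cnj_integrable[OF f right_translation_L2(1)[OF l g]])
    moreover have "?P l \<in> L2 m"
      using fin by (intro L2_I borel_measurable_integrable[OF int]) (simp add: less_top)
    ultimately show "(\<integral>\<^sup>+\<gamma>. ennreal ((cmod (L2_inner m f (tf_shift G (l, \<gamma>) g)))\<^sup>2) \<partial>m') =
      (\<integral>\<^sup>+x. ennreal ((cmod (?P l x))\<^sup>2) \<partial>m)"
      unfolding L2_inner_tf_shift_eq_fourier by (rule plancherel(2))
  qed
  then have "(\<integral>\<^sup>+l. \<integral>\<^sup>+\<gamma>. ennreal ((cmod (L2_inner m f (tf_shift G (l, \<gamma>) g)))\<^sup>2) \<partial>m' \<partial>m) =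
      (\<integral>\<^sup>+l. \<integral>\<^sup>+x. ennreal ((cmod (?P l x))\<^sup>2) \<partial>m \<partial>m)"
    by (rule nn_integral_cong_AE)
  moreover have "(\<lambda>\<nu>. ennreal ((cmod (L2_inner m f (tf_shift G \<nu> g)))\<^sup>2)) \<in> borel_measurable (m \<Otimes>\<^sub>M m')"
    using measurable_L2_inner_tf_shift[OF fm gm] by measurable
  ultimately show ?thesis
    by (simp add: nn_integral_correlation[OF f g] M'.nn_integral_fst[symmetric])
qed

end

section \<open>The size of the index group of a Gabor frame\<close>

theorem theorem5p1:
  fixes G :: "('a, 'b) monoid_scheme" and T :: "'a topology"
    and m :: "'a measure" and m' :: "('a \<Rightarrow> complex) measure"
    and \<Delta> :: "('a \<times> ('a \<Rightarrow> complex)) set"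
    and d :: "('a \<times> ('a \<Rightarrow> complex)) measure"
    and q :: "('a \<times> ('a \<Rightarrow> complex)) set measure"
    and g :: "'a \<Rightarrow> complex" and A B :: real
  assumes "lca_group G T" and "second_countable T"
    and "haar_measure G T m"
    and "dual_haar_measure G T m m'"
    and "subgroup \<Delta> (tf_group G T)" and "closedin (tf_topology G T) \<Delta>"
    and "haar_measure ((tf_group G T)\<lparr>carrier := \<Delta>\<rparr>) (subtopology (tf_topology G T) \<Delta>) d"
    and "haar_measure (tf_group G T Mod \<Delta>) (coset_topology (tf_group G T) (tf_topology G T) \<Delta>) q"
    and "weil_formula (tf_group G T) (m \<Otimes>\<^sub>M m') d q"
    and "g \<in> L2 m"
    and "0 < A" and "A \<le> B"
    and "gabor_frame G m d g A B"
  shows "(compact_space (coset_topology (tf_group G T) (tf_topology G T) \<Delta>) \<and>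
          subgroup_size q < \<infinity>) \<and>
         (ennreal A * subgroup_size q \<le> ennreal ((L2_norm m g)\<^sup>2) \<and>
          ennreal ((L2_norm m g)\<^sup>2) \<le> ennreal B * subgroup_size q)"
proof -
  interpret lca_plancherel G T m m'
    using assms(1-4) by (intro lca_plancherel.intro lca_haar.intro lca_haar_axioms.intro lca_plancherel_axioms.intro)
  let ?H = "tf_group G T" and ?X = "tf_topology G T"
  let ?Y = "coset_topology ?H ?X \<Delta>"
  interpret H: comm_group ?H by (rule comm_group_tf)
  note Q = continuous_map_quotient_group[OF comm_group_tf topspace_tf continuous_map_tf assms(5)]
  have Q_group: "group (?H Mod \<Delta>)"
    using H.subgroup_imp_normal[OF assms(5)] by (rule normal.factorgroup_is_group)
  have \<Delta>: "\<Delta> \<subseteq> carrier ?H" by (rule subgroup.subset[OF assms(5)])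
  have space_d: "space d = \<Delta>"
    using haar_measure_space[OF assms(7)] topspace_tf \<Delta> by auto
  have space_q: "space q = rcosets\<^bsub>?H\<^esub> \<Delta>"
    using haar_measure_space[OF assms(8)] Q(2) by (simp add: FactGroup_def)

  have lower: "ennreal (A * (L2_norm m f)\<^sup>2) \<le> (\<integral>\<^sup>+ \<nu>. ennreal ((cmod (L2_inner m f (tf_shift G \<nu> g)))\<^sup>2) \<partial>d)"
    and upper: "(\<integral>\<^sup>+ \<nu>. ennreal ((cmod (L2_inner m f (tf_shift G \<nu> g)))\<^sup>2) \<partial>d) \<le> ennreal (B * (L2_norm m f)\<^sup>2)"
    if "f \<in> L2 m" for f
    using assms(13) that by (simp_all add: gabor_frame_def)
  have gm: "g \<in> borel_measurable m" using assms(10) by (simp add: L2_def)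

  obtain K where K: "K \<in> sets m" "0 < emeasure m K" "emeasure m K < \<infinity>"
    using compact_set_finite_positive by metis
  \<comment> \<open>Any \<open>f\<close> of positive norm serves as a test function.\<close>
  define f :: "'a \<Rightarrow> complex" where "f x = of_real (indicator K x)" for x
  have f_sq: "(cmod (f x))\<^sup>2 = indicator K x" for x by (simp add: f_def indicator_def)
  have f: "f \<in> L2 m"
    using K by (simp add: L2_def f_sq) (simp add: f_def[abs_def])
  have fm: "f \<in> borel_measurable m" using f by (simp add: L2_def)
  define c where "c = (L2_norm m f)\<^sup>2"
  have c: "0 < c"
    using K by (simp add: c_def L2_norm_def f_sq measure_def enn2real_positive_iff)

  \<comment> \<open>If \<open>g\<close> vanished almost everywhere, so would all its shifts, against the lower frame bound.\<close>
  have g0: "L2_norm m g \<noteq> 0"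
  proof
    assume g0: "L2_norm m g = 0"
    have zero: "L2_inner m f (tf_shift G \<nu> g) = 0" if \<nu>d: "\<nu> \<in> space d" for \<nu>
    proof -
      obtain l \<gamma> where \<nu>: "\<nu> = (l, \<gamma>)" "l \<in> carrier G" "\<gamma> \<in> characters G T"
        using \<nu>d \<Delta> by (auto simp: space_d carrier_dual)
      note S = tf_shift_L2[OF \<nu>(2,3) assms(10)]
      have "integrable m (\<lambda>x. (cmod (tf_shift G \<nu> g x))\<^sup>2)" using S(1) by (simp add: L2_def \<nu>)
      moreover have "(\<integral>x. (cmod (tf_shift G \<nu> g x))\<^sup>2 \<partial>m) = 0"
        using S(2) g0 by (simp add: L2_norm_def \<nu>)
      ultimately have "AE x in m. (cmod (tf_shift G \<nu> g x))\<^sup>2 = 0"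
        by (simp add: integral_nonneg_eq_0_iff_AE)
      then have "AE x in m. f x * cnj (tf_shift G \<nu> g x) = 0" by eventually_elim simp
      then show ?thesis unfolding L2_inner_def by (rule integral_eq_zero_AE)
    qed
    have "(\<integral>\<^sup>+ \<nu>. ennreal ((cmod (L2_inner m f (tf_shift G \<nu> g)))\<^sup>2) \<partial>d) = 0"
      by (simp add: zero cong: nn_integral_cong)
    with lower[OF f] have "ennreal (A * c) \<le> 0" by (simp add: c_def)
    then show False using c assms(11) by (simp add: mult_le_0_iff)
  qed

  define F where "F z = (cmod (L2_inner m f (tf_shift G z g)))\<^sup>2" for z
  have F_nonneg: "0 \<le> F z" for z by (simp add: F_def)
  define N where "N = c * (L2_norm m g)\<^sup>2"
  have N: "0 < N" using c g0 by (simp add: N_def)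
  have Fm: "F \<in> borel_measurable (m \<Otimes>\<^sub>M m')"
    unfolding F_def using measurable_L2_inner_tf_shift[OF fm gm] by measurable
  have F_nn: "(\<integral>\<^sup>+z. ennreal (F z) \<partial>(m \<Otimes>\<^sub>M m')) = ennreal N"
    unfolding F_def N_def c_def by (rule orthogonality_relation[OF f assms(10)])
  have F_int: "integrable (m \<Otimes>\<^sub>M m') F"
    using Fm F_nn by (intro integrableI_nonneg) (auto simp: F_def)
  have F_eq: "(\<integral>z. F z \<partial>(m \<Otimes>\<^sub>M m')) = N"
    using nn_integral_eq_integral[OF F_int] F_nn N F_nonneg
    by (simp add: integral_nonneg_AE)

  define \<Phi> where "\<Phi> C = (\<integral>\<nu>. F ((SOME z. z \<in> C) \<otimes>\<^bsub>?H\<^esub> \<nu>) \<partial>d)" for C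
  have \<Phi>: "A * c \<le> \<Phi> C \<and> \<Phi> C \<le> B * c" if C: "C \<in> space q" for C
  proof -
    define z where "z = (SOME z. z \<in> C)"
    obtain w where w: "w \<in> carrier ?H" "C = \<Delta> #>\<^bsub>?H\<^esub> w"
      using C unfolding space_q RCOSETS_def by blast
    have "w \<in> C" unfolding w(2) using H.rcos_self[OF w(1) assms(5)] .
    then have "z \<in> C" unfolding z_def by (rule someI)
    then have "z \<in> carrier ?H" unfolding w(2) using H.r_coset_subset_G[OF \<Delta> w(1)] by blast
    then obtain l \<gamma> where z: "z = (l, \<gamma>)" "l \<in> carrier G" "\<gamma> \<in> characters G T"
      by (auto simp: carrier_dual)
    let ?h = "\<lambda>x. f (l \<otimes>\<^bsub>G\<^esub> x) * cnj (\<gamma> x)"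
    define E where "E \<nu> = (cmod (L2_inner m ?h (tf_shift G \<nu> g)))\<^sup>2" for \<nu>
    note h = L2_tf_shift_adjoint[OF z(2,3) f]
    have hm: "?h \<in> borel_measurable m" using h(1) by (simp add: L2_def)
    have FE: "F (z \<otimes>\<^bsub>?H\<^esub> \<nu>) = E \<nu>" if \<nu>d: "\<nu> \<in> space d" for \<nu>
    proof -
      obtain k \<eta> where "\<nu> = (k, \<eta>)" "k \<in> carrier G" "\<eta> \<in> characters G T"
        using \<nu>d \<Delta> by (auto simp: space_d carrier_dual)
      then show ?thesis
        unfolding F_def E_def z(1) using cmod_L2_inner_tf_shift_mult[OF fm gm z(2,3)] by simp
    qed
    \<comment> \<open>The Borel sets of the plane include the product sigma-algebra, so \<open>E\<close> is Borel measurable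
        on the plane and restricts to \<open>\<Delta>\<close>.\<close>
    have Em: "E \<in> borel_measurable d"
    proof -
      have "E \<in> borel_measurable (m \<Otimes>\<^sub>M m')"
        unfolding E_def using measurable_L2_inner_tf_shift[OF hm gm] by measurable
      moreover have "(\<lambda>\<nu>. \<nu>) \<in> d \<rightarrow>\<^sub>M m \<Otimes>\<^sub>M m'"
      proof -
        have "continuous_map (subtopology ?X \<Delta>) ?X (\<lambda>\<nu>. \<nu>)" by (simp add: continuous_map_from_subtopology)
        from measurable_compose[OF continuous_map_measurable[OF this] id_measurable_borel_of_prod]
        have "(\<lambda>\<nu>. \<nu>) \<in> borel_of (subtopology ?X \<Delta>) \<rightarrow>\<^sub>M borel_of T \<Otimes>\<^sub>M borel_of DT" .
        moreover have "sets (m \<Otimes>\<^sub>M m') = sets (borel_of T \<Otimes>\<^sub>M borel_of DT)"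
          by (intro sets_pair_measure_cong sets_m sets_dual)
        ultimately show ?thesis
          using measurable_cong_sets[OF haar_measure_sets[OF assms(7)]] by blast
      qed
      ultimately show ?thesis using measurable_compose by blast
    qed
    have lo: "ennreal (A * c) \<le> (\<integral>\<^sup>+\<nu>. ennreal (E \<nu>) \<partial>d)" and up: "(\<integral>\<^sup>+\<nu>. ennreal (E \<nu>) \<partial>d) \<le> ennreal (B * c)"
      using lower[OF h(1)] upper[OF h(1)] unfolding E_def c_def h(2) by simp_all
    have "integrable d E"
      using Em up by (intro integrableI_nonneg) (auto simp: E_def intro: le_less_trans)
    then have "(\<integral>\<^sup>+\<nu>. ennreal (E \<nu>) \<partial>d) = ennreal (\<integral>\<nu>. E \<nu> \<partial>d)"
      by (rule nn_integral_eq_integral) (simp add: E_def)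
    moreover have "\<Phi> C = (\<integral>\<nu>. E \<nu> \<partial>d)"
      unfolding \<Phi>_def z_def[symmetric] by (intro Bochner_Integration.integral_cong refl FE)
    moreover have "0 \<le> (\<integral>\<nu>. E \<nu> \<partial>d)" by (simp add: E_def)
    ultimately show ?thesis using lo up c assms(11,12) by simp
  qed

  have weil: "(\<integral>C. \<Phi> C \<partial>q) = N"
  proof -
    have "integrable (m \<Otimes>\<^sub>M m') (\<lambda>z. complex_of_real (F z))" using F_int by simp
    then have "(\<integral>z. complex_of_real (F z) \<partial>(m \<Otimes>\<^sub>M m')) =
        (\<integral>C. (\<integral>\<nu>. complex_of_real (F ((SOME z. z \<in> C) \<otimes>\<^bsub>?H\<^esub> \<nu>)) \<partial>d) \<partial>q)"
      using assms(9) unfolding weil_formula_def by blast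
    then have "complex_of_real N = complex_of_real (\<integral>C. \<Phi> C \<partial>q)"
      by (simp add: F_eq \<Phi>_def)
    then show ?thesis by simp
  qed
  \<comment> \<open>The Bochner integral of a function that is not integrable is zero by convention, whereas this
    one is positive.\<close>
  have \<Phi>_int: "integrable q \<Phi>"
    using weil N not_integrable_integral_eq by force
  have \<Phi>_pos: "0 \<le> \<Phi> C" if "C \<in> space q" for C
    using \<Phi>[OF that] mult_pos_pos[OF assms(11) c] by linarith
  have \<Phi>_nn: "(\<integral>\<^sup>+C. ennreal (\<Phi> C) \<partial>q) = ennreal N"
    using nn_integral_eq_integral[OF \<Phi>_int] \<Phi>_pos weil by (simp add: AE_I2)
  have size: "subgroup_size q = emeasure q (space q)" by (simp add: subgroup_size_def)
  have lo: "ennreal (A * c) * subgroup_size q \<le> ennreal N"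
  proof -
    have "ennreal (A * c) * subgroup_size q = (\<integral>\<^sup>+C. ennreal (A * c) \<partial>q)" by (simp add: size)
    also have "\<dots> \<le> (\<integral>\<^sup>+C. ennreal (\<Phi> C) \<partial>q)"
      using \<Phi> by (intro nn_integral_mono ennreal_leI) simp
    finally show ?thesis by (simp add: \<Phi>_nn)
  qed
  have up: "ennreal N \<le> ennreal (B * c) * subgroup_size q"
  proof -
    have "(\<integral>\<^sup>+C. ennreal (\<Phi> C) \<partial>q) \<le> (\<integral>\<^sup>+C. ennreal (B * c) \<partial>q)"
      using \<Phi> by (intro nn_integral_mono ennreal_leI) simp
    then show ?thesis by (simp add: \<Phi>_nn size)
  qed
  have fin: "subgroup_size q < \<infinity>"
  proof (rule ccontr)
    assume "\<not> subgroup_size q < \<infinity>"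
    then have "subgroup_size q = \<infinity>" by (simp add: less_top[symmetric])
    then show False using lo c assms(11) by (simp add: ennreal_mult_top top_unique)
  qed
  then obtain s where s: "subgroup_size q = ennreal s" "0 \<le> s"
    by (cases "subgroup_size q") auto
  have "A * c * s \<le> N" "N \<le> B * c * s"
    using lo up c N s assms(11,12) by (simp_all flip: ennreal_mult)
  then have "A * s \<le> (L2_norm m g)\<^sup>2" "(L2_norm m g)\<^sup>2 \<le> B * s"
    using c by (simp_all add: N_def mult.commute mult.left_commute)
  then have "ennreal A * subgroup_size q \<le> ennreal ((L2_norm m g)\<^sup>2)"
    "ennreal ((L2_norm m g)\<^sup>2) \<le> ennreal B * subgroup_size q"
    using s assms(11,12) by (simp_all flip: ennreal_mult add: ennreal_leI)
  moreover have "compact_space ?Y"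
    using fin size by (intro haar_measure_finite_imp_compact[OF Q_group Q(2,1) assms(8)]) simp
  ultimately show ?thesis using fin by simp
qed

end
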